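(* Let $\Gamma\subset\mathbb{R}$ be a separated, relatively dense set and let $\mathcal{G}\in W_0\cap C(\mathbb{R})$. Suppose there is a constant $C_1>0$ such that $$C_1\|\mathbf{c}\|_\infty\le\Big\|\sum_{\gamma\in\Gamma}c_\gamma\,\mathcal{G}(\cdot-\gamma)\Big\|_\infty\quad\text{for every }\mathbf{c}=\{c_\gamma\}\in l^\infty(\Gamma).$$ Then for every $p\in[1,\infty]$ there is a constant $C_{1,p}>0$ such that $$C_{1,p}\|\mathbf{c}\|_p\le\Big\|\sum_{\gamma\in\Gamma}c_\gamma\,\mathcal{G}(\cdot-\gamma)\Big\|_p\quad\text{for every }\mathbf{c}=\{c_\gamma\}\in l^p(\Gamma).$$
   Context: A countable set $\Gamma\subset\mathbb{R}$ is separated if $\inf_{\gamma,\gamma'\in\Gamma,\gamma\ne\gamma'}|\gamma-\gamma'|>0$; it is relatively dense if $D^-(\Gamma)>0$, where $D^-(\Gamma)=\lim_{R\to\infty}\inf_{x\in\mathbb{R}}\frac{\#(\Gamma\cap[x-R,x+R])}{2R}$. The Wiener amalgam space $W_0$ consists of the measurable functions $\mathcal{G}:\mathbb{R}\to\mathbb{C}$ with $\|\mathcal{G}\|_W:=\sum_{k\in\mathbb{Z}}\|\mathcal{G}\|_{L^\infty(k,k+1)}<\infty$. $C(\mathbb{R})$ is the set of continuous functions on $\mathbb{R}$. Norms of functions are $L^p(\mathbb{R})$ norms and norms of (complex) sequences are $l^p$ norms. *)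

theory Defs
  imports "HOL-Analysis.Analysis" "HOL-Probability.Essential_Supremum"
begin

text \<open>
  \<open>L\<^sup>p\<close> norm with values in \<open>[0,\<infinity>]\<close>, for \<open>p \<in> [1,\<infinity>]\<close>. There is no real power on type \<open>ennreal\<close>,
  so the \<open>p\<close>-th root of the integral is taken in the reals when the integral is finite.
\<close>

definition Lp_norm :: "ennreal \<Rightarrow> 'a measure \<Rightarrow> ('a \<Rightarrow> complex) \<Rightarrow> ennreal" where
  "Lp_norm p M f =
     (if p = \<infinity> then esssup M (\<lambda>x. ennreal (norm (f x)))
      else let I = (\<integral>\<^sup>+ x. ennreal (norm (f x) powr enn2real p) \<partial>M)
           in if I = \<infinity> then \<infinity> else ennreal (enn2real I powr (1 / enn2real p)))"

text \<open>
  A sequence indexed by \<open>\<Gamma>\<close> is a function \<open>c\<close> on the reals of which only the values on \<open>\<Gamma>\<close> matter;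
  its \<open>l\<^sup>p\<close> norm is the \<open>L\<^sup>p\<close> norm for counting measure on \<open>\<Gamma>\<close>. The only null set of that measure is
  empty, so for \<open>p = \<infinity>\<close> this is the plain supremum over \<open>\<Gamma>\<close>.
\<close>

abbreviation lp_norm :: "ennreal \<Rightarrow> 'a set \<Rightarrow> ('a \<Rightarrow> complex) \<Rightarrow> ennreal" where
  "lp_norm p \<Gamma> c \<equiv> Lp_norm p (count_space \<Gamma>) c"

definition lp_space :: "ennreal \<Rightarrow> 'a set \<Rightarrow> ('a \<Rightarrow> complex) set" where
  "lp_space p \<Gamma> = {c. lp_norm p \<Gamma> c < \<infinity>}"

definition separated_set :: "real set \<Rightarrow> bool" where
  "separated_set \<Gamma> \<longleftrightarrow> countable \<Gamma> \<and>
     (INF (s, t)\<in>{(s, t). s \<in> \<Gamma> \<and> t \<in> \<Gamma> \<and> s \<noteq> t}. ennreal \<bar>s - t\<bar>) > 0"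

text \<open>
  The number of points is counted in \<open>[0,\<infinity>]\<close>. The limit exists for every \<open>\<Gamma>\<close>: with half-open
  intervals the infimum over \<open>x\<close> is superadditive in \<open>R\<close>, and it brackets the one for closed
  intervals up to replacing \<open>R\<close> by \<open>R + 1\<close>.
\<close>

definition lower_density :: "real set \<Rightarrow> ennreal" where
  "lower_density \<Gamma> =
     Lim at_top (\<lambda>R::real. INF x. emeasure (count_space UNIV) (\<Gamma> \<inter> {x - R..x + R}) / ennreal (2 * R))"

definition relatively_dense :: "real set \<Rightarrow> bool" where
  "relatively_dense \<Gamma> \<longleftrightarrow> lower_density \<Gamma> > 0"

definition wiener_norm :: "(real \<Rightarrow> complex) \<Rightarrow> ennreal" where
  "wiener_norm G =
     (\<Sum>\<^sub>\<infinity>k::int. Lp_norm \<infinity> (lebesgue_on {real_of_int k<..<real_of_int k + 1}) G)"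

definition wiener_amalgam :: "(real \<Rightarrow> complex) set" where
  "wiener_amalgam = {G. G \<in> borel_measurable lebesgue \<and> wiener_norm G < \<infinity>}"

text \<open>
  The series is summed pointwise. For separated \<open>\<Gamma>\<close>, continuous \<open>G\<close> in the Wiener amalgam space and
  bounded \<open>c\<close> (in particular \<open>c\<close> in any \<open>l\<^sup>p\<close>) it converges absolutely at every point.
\<close>

definition shift_series :: "real set \<Rightarrow> (real \<Rightarrow> complex) \<Rightarrow> (real \<Rightarrow> complex) \<Rightarrow> real \<Rightarrow> complex" where
  "shift_series \<Gamma> G c x = (\<Sum>\<^sub>\<infinity>\<gamma>\<in>\<Gamma>. c \<gamma> * G (x - \<gamma>))"

end

theory Submission
  imports Defs
begin

text \<open>
  The proof localizes the \<open>l\<^sup>\<infinity>\<close> bound to blocks of length \<open>N\<close> and sums the local bounds in \<open>l\<^sup>p\<close>.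
  Write \<open>F = \<Sum> c \<gamma> G (\<cdot> - \<gamma>)\<close>, and let \<open>a k\<close> be the largest \<open>cmod (c \<gamma>)\<close> over the \<open>\<gamma>\<close> in the block
  \<open>[k N, (k + 1) N)\<close>. Applying the assumed bound to \<open>c\<close> times a tent function \<open>\<psi>\<close> of slope \<open>1 / N\<close>
  around that block gives a point \<open>x\<close> with
  \<open>C\<^sub>1 / 2 * a k \<le> cmod (\<Sum> \<psi> \<gamma> c \<gamma> G (x - \<gamma>))\<close>.

  Replacing this series by \<open>\<psi> x F (x + s)\<close> with \<open>0 \<le> s \<le> \<delta>\<close> costs
  \<open>cmod (c \<gamma>)\<close> times \<open>cmod (G (x - \<gamma>)) * min 1 (\<bar>x - \<gamma>\<bar> / N) + cmod (G (x + s - \<gamma>) - G (x - \<gamma>))\<close>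
  in each term. Since \<open>G\<close> is continuous and its local suprema are summable, this error is dominated by a
  kernel \<open>\<kappa>\<close> on the integers whose total mass \<open>\<eta>\<close> is arbitrarily small once \<open>N\<close> is large and \<open>\<delta>\<close>
  is small (\<open>small_perturbation_kernel\<close>). Grouping the error by blocks turns it into a convolution:
  \<open>C\<^sub>1 / 2 * a k \<le> m k + (\<Sum>i. V i * a (k + i))\<close>, where \<open>m k\<close> is a lower bound of \<open>cmod F\<close> on an
  interval of length \<open>\<delta>\<close> near block \<open>k\<close>, and the mass of \<open>V\<close> is at most \<open>11 M \<eta>\<close> with \<open>M\<close> bounding
  the number of points of \<open>\<Gamma>\<close> per unit length (\<open>local_stability\<close>).

  Convolution with \<open>V\<close> has norm at most the mass of \<open>V\<close> on every \<open>l\<^sup>p\<close>, so the convolution is absorbed into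
  the left side (\<open>absorb_convolution\<close>), and the intervals on which \<open>cmod F \<ge> m k\<close> overlap boundedly, so
  \<open>\<Sum> m k powr p\<close> is controlled by the integral of \<open>cmod F powr p\<close>
  (\<open>sum_interval_minorants_le\<close>). The smallness required of \<open>\<eta>\<close> does not involve the block length:
  suprema over blocks appear on both sides of the local inequality, and the passage from block suprema
  to \<open>l\<^sup>p\<close> norms, which does cost a power of \<open>N\<close>, happens only once, at the end.
\<close>

section \<open>Absorbing a convolution of small mass in sequence spaces\<close>

lemma powr_tangent_at_one:
  fixes x p :: real
  assumes "0 \<le> x" "1 \<le> p"
  shows "1 + p * (x - 1) \<le> x powr p"
proof (cases "x = 0")
  case False
  then have "x > 0" using assms by simp
  have "((\<lambda>x. x powr p) has_real_derivative p) (at 1 within {0<..})"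
    by (auto intro!: derivative_eq_intros)
  then have "x powr p - 1 powr p \<ge> p * (x - 1)"
    by (intro convex_on_imp_above_tangent[OF powr_convex[OF \<open>1 \<le> p\<close>]])
       (use \<open>x > 0\<close> in \<open>auto simp: interior_open\<close>)
  then show ?thesis by simp
qed (use assms in auto)

text \<open>
  Jensen's inequality for weights of total mass at most \<open>S\<close>, by the tangent of \<open>x powr p\<close> at \<open>1\<close> taken
  at the points \<open>a i / m\<close>, where \<open>m\<close> is the sum divided by \<open>S\<close>. Missing mass only helps: as \<open>p \<ge> 1\<close>,
  \<open>S \<le> sum v I + p * (S - sum v I)\<close>.
\<close>

lemma weighted_sum_powr_le:
  fixes v a :: "'i \<Rightarrow> real"
  assumes "finite I" and v: "\<And>i. i \<in> I \<Longrightarrow> 0 \<le> v i" and a: "\<And>i. i \<in> I \<Longrightarrow> 0 \<le> a i"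
    and S: "sum v I \<le> S" "0 < S" and p: "1 \<le> p"
  shows "(\<Sum>i\<in>I. v i * a i) powr p \<le> S powr (p - 1) * (\<Sum>i\<in>I. v i * a i powr p)"
proof (cases "(\<Sum>i\<in>I. v i * a i) = 0")
  case True
  then show ?thesis using v p by (simp add: sum_nonneg)
next
  case False
  define m where "m = (\<Sum>i\<in>I. v i * a i) / S"
  have "(\<Sum>i\<in>I. v i * a i) \<ge> 0" by (intro sum_nonneg mult_nonneg_nonneg v a)
  with False have m: "m > 0" using S by (simp add: m_def)
  have sum_m: "(\<Sum>i\<in>I. v i * a i) = S * m" using S by (simp add: m_def)
  have "S \<le> sum v I + p * (S - sum v I)"
    using mult_right_mono[OF p, of "S - sum v I"] S by simp
  also have "\<dots> = (\<Sum>i\<in>I. v i * (1 + p * (a i / m - 1)))"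
  proof -
    have "(\<Sum>i\<in>I. v i * (1 + p * (a i / m - 1)))
        = (\<Sum>i\<in>I. v i + p * ((v i * a i) / m - v i))"
      by (intro sum.cong refl) (simp add: algebra_simps)
    also have "\<dots> = sum v I + p * ((\<Sum>i\<in>I. v i * a i) / m - sum v I)"
      by (simp add: sum.distrib sum_subtractf sum_divide_distrib flip: sum_distrib_left)
    finally show ?thesis using m sum_m by simp
  qed
  also have "\<dots> \<le> (\<Sum>i\<in>I. v i * (a i / m) powr p)"
    by (intro sum_mono mult_left_mono powr_tangent_at_one v p)
       (use a m in \<open>auto intro: divide_nonneg_pos\<close>)
  also have "\<dots> = (\<Sum>i\<in>I. v i * a i powr p) / m powr p"
    using a m by (simp add: powr_divide sum_divide_distrib)
  finally have "S * m powr p \<le> (\<Sum>i\<in>I. v i * a i powr p)"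
    using m by (simp add: field_simps)
  then have "S powr (p - 1) * (S * m powr p) \<le> S powr (p - 1) * (\<Sum>i\<in>I. v i * a i powr p)"
    by (rule mult_left_mono) simp
  moreover have "S powr (p - 1) * (S * m powr p) = (S * m) powr p"
    using S m by (simp add: powr_mult powr_diff)
  ultimately show ?thesis by (simp add: sum_m)
qed

lemma powr_add_le:
  fixes x y p :: real
  assumes "0 \<le> x" "0 \<le> y" "0 \<le> p"
  shows "(x + y) powr p \<le> 2 powr p * (x powr p + y powr p)"
proof -
  have "(x + y) powr p \<le> (2 * max x y) powr p"
    using assms by (intro powr_mono2) auto
  also have "\<dots> = 2 powr p * max x y powr p"
    using assms by (simp add: powr_mult)
  also have "max x y powr p \<le> x powr p + y powr p"
    by (simp add: max_def)
  finally show ?thesis by simp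
qed

lemma bounded_times_summable:
  fixes V b :: "'i \<Rightarrow> real"
  assumes "V summable_on UNIV" "\<And>i. 0 \<le> V i" "\<And>i. 0 \<le> b i" "\<And>i. b i \<le> A"
  shows "(\<lambda>i. V i * b i) summable_on UNIV"
    and "(\<Sum>\<^sub>\<infinity>i. V i * b i) \<le> (\<Sum>\<^sub>\<infinity>i. V i) * A"
proof -
  have sA: "(\<lambda>i. V i * A) summable_on UNIV" by (intro summable_on_cmult_left assms)
  show s: "(\<lambda>i. V i * b i) summable_on UNIV"
    by (rule summable_on_comparison_test[OF sA]) (use assms in \<open>auto intro: mult_left_mono\<close>)
  have "(\<Sum>\<^sub>\<infinity>i. V i * b i) \<le> (\<Sum>\<^sub>\<infinity>i. V i * A)"
    by (rule infsum_mono[OF s sA]) (use assms in \<open>auto intro: mult_left_mono\<close>)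
  also have "\<dots> = (\<Sum>\<^sub>\<infinity>i. V i) * A" by (rule infsum_cmult_left) (use assms in auto)
  finally show "(\<Sum>\<^sub>\<infinity>i. V i * b i) \<le> (\<Sum>\<^sub>\<infinity>i. V i) * A" .
qed

text \<open>
  The finite inequality bounds every partial sum by the \<open>p\<close>-th root of the right-hand side, so it passes
  to the limit.
\<close>

lemma infsum_powr_le:
  fixes V b :: "'i \<Rightarrow> real"
  assumes V: "V summable_on UNIV" "\<And>i. 0 \<le> V i" "(\<Sum>\<^sub>\<infinity>i. V i) \<le> S" "0 < S"
    and b: "\<And>i. 0 \<le> b i" "\<And>i. b i \<le> A" and p: "1 \<le> p"
  shows "(\<Sum>\<^sub>\<infinity>i. V i * b i) powr p \<le> S powr (p - 1) * (\<Sum>\<^sub>\<infinity>i. V i * b i powr p)"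
proof -
  have s: "(\<lambda>i. V i * b i) summable_on UNIV"
    by (rule bounded_times_summable) (use V b in auto)
  have sp: "(\<lambda>i. V i * b i powr p) summable_on UNIV"
    by (rule bounded_times_summable[where A = "A powr p"])
       (use V b p in \<open>auto intro!: powr_mono2\<close>)
  let ?Z = "S powr (p - 1) * (\<Sum>\<^sub>\<infinity>i. V i * b i powr p)"
  have Z: "0 \<le> ?Z" by (intro mult_nonneg_nonneg infsum_nonneg) (use V in auto)
  have fin: "(\<Sum>i\<in>I. V i * b i) \<le> ?Z powr (1 / p)" if "finite I" for I
  proof -
    have "sum V I \<le> S"
      using finite_sum_le_infsum[OF V(1) that] V by (auto intro: order_trans)
    then have "(\<Sum>i\<in>I. V i * b i) powr p \<le> S powr (p - 1) * (\<Sum>i\<in>I. V i * b i powr p)"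
      using that V b p by (intro weighted_sum_powr_le) auto
    also have "\<dots> \<le> ?Z"
      by (intro mult_left_mono finite_sum_le_infsum sp that) (use V in auto)
    finally have "((\<Sum>i\<in>I. V i * b i) powr p) powr (1 / p) \<le> ?Z powr (1 / p)"
      using p by (intro powr_mono2) auto
    then show ?thesis using p V b by (simp add: powr_powr sum_nonneg)
  qed
  have "(\<Sum>\<^sub>\<infinity>i. V i * b i) \<le> ?Z powr (1 / p)"
    by (rule infsum_le_finite_sums[OF s]) (use fin in auto)
  then have "(\<Sum>\<^sub>\<infinity>i. V i * b i) powr p \<le> (?Z powr (1 / p)) powr p"
    using p V b by (intro powr_mono2) (auto intro!: infsum_nonneg)
  also have "\<dots> = ?Z" using p Z by (simp add: powr_powr)
  finally show ?thesis .
qed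

lemma has_sum_finite_sum:
  fixes f :: "'k \<Rightarrow> 'i \<Rightarrow> real"
  assumes "finite F" "\<And>k. k \<in> F \<Longrightarrow> (f k has_sum s k) A"
  shows "((\<lambda>i. \<Sum>k\<in>F. f k i) has_sum (\<Sum>k\<in>F. s k)) A"
  using assms by (induction F rule: finite_induct) (auto intro: has_sum_add)

text \<open>
  By Jensen and translation invariance, the convolution with \<open>V\<close> contributes at most \<open>S powr p * A\<close> to
  the sum \<open>A\<close> of the \<open>p\<close>-th powers, where \<open>S = \<alpha> / 4\<close> bounds the mass of \<open>V\<close>. The factor \<open>2 powr p\<close>
  lost in separating the two terms on the right turns this into \<open>(\<alpha> / 2) powr p * A\<close>, which is at most
  half of the left-hand side \<open>\<alpha> powr p * A\<close>. Subtracting it is legitimate because \<open>A\<close> is finite.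
\<close>

lemma absorb_convolution:
  fixes a m V :: "int \<Rightarrow> real"
  assumes a: "\<And>k. 0 \<le> a k" and a_sum: "(\<lambda>k. a k powr p) summable_on UNIV"
    and m: "\<And>k. 0 \<le> m k" "\<And>F. finite F \<Longrightarrow> (\<Sum>k\<in>F. m k powr p) \<le> D"
    and V: "V summable_on UNIV" "\<And>i. 0 \<le> V i" "4 * (\<Sum>\<^sub>\<infinity>i. V i) \<le> \<alpha>"
    and \<alpha>: "0 < \<alpha>" and p: "1 \<le> p"
    and ineq: "\<And>k. \<alpha> * a k \<le> m k + (\<Sum>\<^sub>\<infinity>i. V i * a (k + i))"
  shows "(\<Sum>\<^sub>\<infinity>k. a k powr p) \<le> 2 * (2 / \<alpha>) powr p * D"
proof -
  define A where "A = (\<Sum>\<^sub>\<infinity>k. a k powr p)"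
  define S where "S = \<alpha> / 4"
  have S: "0 < S" using \<alpha> by (simp add: S_def)
  have VS: "(\<Sum>\<^sub>\<infinity>i. V i) \<le> S" using V by (simp add: S_def)
  have A0: "0 \<le> A" unfolding A_def by (rule infsum_nonneg) simp
  have A_fin: "(\<Sum>k\<in>F. a k powr p) \<le> A" if "finite F" for F
    unfolding A_def by (rule finite_sum_le_infsum) (use a_sum that in auto)
  have a_pow: "a k powr p \<le> A" for k using A_fin[of "{k}"] by simp
  have a_le: "a k \<le> A powr (1 / p)" for k
  proof -
    have "(a k powr p) powr (1 / p) \<le> A powr (1 / p)"
      using a_pow p by (intro powr_mono2) auto
    then show ?thesis using p a by (simp add: powr_powr)
  qed
  define Z where "Z k = (\<Sum>\<^sub>\<infinity>i. V i * a (k + i) powr p)" for k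
  have Zsum: "(\<lambda>i. V i * a (k + i) powr p) summable_on UNIV" for k
    by (rule bounded_times_summable[where A = A]) (use V a_pow in auto)
  have each: "(\<alpha> * a k) powr p \<le> 2 powr p * (m k powr p + S powr (p - 1) * Z k)" for k
  proof -
    let ?Y = "\<Sum>\<^sub>\<infinity>i. V i * a (k + i)"
    have Y: "0 \<le> ?Y" by (rule infsum_nonneg) (use V a in auto)
    have "(\<alpha> * a k) powr p \<le> (m k + ?Y) powr p"
      using ineq a \<alpha> p by (intro powr_mono2) auto
    also have "\<dots> \<le> 2 powr p * (m k powr p + ?Y powr p)"
      using m Y p by (intro powr_add_le) auto
    also have "?Y powr p \<le> S powr (p - 1) * Z k"
      unfolding Z_def by (rule infsum_powr_le[where A = "A powr (1/p)"]) (use V VS S a a_le p in auto)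
    finally show ?thesis by simp
  qed
  have fin: "(\<Sum>k\<in>F. a k powr p) \<le> (2 / \<alpha>) powr p * D + A / 2" if F: "finite F" for F
  proof -
    have "(\<Sum>k\<in>F. Z k) = (\<Sum>\<^sub>\<infinity>i. \<Sum>k\<in>F. V i * a (k + i) powr p)"
      unfolding Z_def
      by (rule infsumI[symmetric], rule has_sum_finite_sum) (use F Zsum in auto)
    also have "\<dots> = (\<Sum>\<^sub>\<infinity>i. V i * (\<Sum>k\<in>F. a (k + i) powr p))"
      by (simp add: sum_distrib_left)
    also have "\<dots> \<le> (\<Sum>\<^sub>\<infinity>i. V i) * A"
    proof (rule bounded_times_summable(2))
      fix i
      have "(\<Sum>k\<in>F. a (k + i) powr p) = (\<Sum>k\<in>(\<lambda>k. k + i) ` F. a k powr p)"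
        by (subst sum.reindex) (auto simp: inj_on_def)
      also have "\<dots> \<le> A" using F by (intro A_fin) auto
      finally show "(\<Sum>k\<in>F. a (k + i) powr p) \<le> A" .
    qed (use V in \<open>auto intro: sum_nonneg\<close>)
    also have "\<dots> \<le> S * A" using VS A0 by (rule mult_right_mono)
    finally have Z: "(\<Sum>k\<in>F. Z k) \<le> S * A" .
    have "\<alpha> powr p * (\<Sum>k\<in>F. a k powr p) = (\<Sum>k\<in>F. (\<alpha> * a k) powr p)"
      using \<alpha> a by (simp add: powr_mult sum_distrib_left)
    also have "\<dots> \<le> (\<Sum>k\<in>F. 2 powr p * (m k powr p + S powr (p - 1) * Z k))"
      by (intro sum_mono each)
    also have "\<dots> = 2 powr p * ((\<Sum>k\<in>F. m k powr p) + S powr (p - 1) * (\<Sum>k\<in>F. Z k))"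
      by (simp add: sum.distrib flip: sum_distrib_left)
    also have "\<dots> \<le> 2 powr p * (D + S powr (p - 1) * (S * A))"
      using m(2)[OF F] Z by (intro mult_left_mono add_mono) auto
    also have "S powr (p - 1) * (S * A) = S powr p * A"
      using S by (simp add: powr_diff)
    also have "2 powr p * (D + S powr p * A) = 2 powr p * D + (2 * S) powr p * A"
      using S by (simp add: powr_mult algebra_simps)
    also have "(2 * S) powr p \<le> \<alpha> powr p / 2"
    proof -
      have "(2 * S) powr p = (1 / 2) powr p * \<alpha> powr p"
        using \<alpha> by (simp add: S_def powr_divide)
      also have "(1 / 2) powr p \<le> (1 / 2 :: real) powr 1"
        using p by (intro powr_mono') auto
      finally show ?thesis by (simp add: mult_right_mono)
    qed
    finally have "\<alpha> powr p * (\<Sum>k\<in>F. a k powr p) \<le> 2 powr p * D + \<alpha> powr p / 2 * A"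
      using A0 by (auto simp: mult_right_mono)
    then have "\<alpha> powr p * (\<Sum>k\<in>F. a k powr p) \<le> \<alpha> powr p * ((2 / \<alpha>) powr p * D + A / 2)"
      using \<alpha> by (simp add: powr_divide algebra_simps)
    then show ?thesis using \<alpha> by simp
  qed
  have "A \<le> (2 / \<alpha>) powr p * D + A / 2"
    unfolding A_def
    by (rule infsum_le_finite_sums[OF a_sum]) (use fin in \<open>auto simp: A_def\<close>)
  then show ?thesis by (simp add: A_def)
qed

section \<open>Summable majorants for functions in the Wiener amalgam space\<close>

text \<open>
  For a continuous function the essential bound on the open interval between consecutive integers holds at
  every point, and by closure at the left end point, which makes it a bound in terms of the floor of \<open>t\<close>.
\<close>

lemma wiener_majorant:
  assumes G: "G \<in> wiener_amalgam" and cont: "continuous_on UNIV G"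
  obtains q :: "int \<Rightarrow> real" where "\<And>l. 0 \<le> q l" "q summable_on UNIV" "\<And>t. cmod (G t) \<le> q \<lfloor>t\<rfloor>"
proof -
  define E where "E k = Lp_norm \<infinity> (lebesgue_on {real_of_int k<..<real_of_int k + 1}) G" for k :: int
  define W where "W = wiener_norm G"
  have W: "W < \<infinity>" using G by (simp add: wiener_amalgam_def W_def)
  have EF: "sum E F \<le> W" if "finite F" for F
  proof -
    have "sum E F = infsum E F" using that by simp
    also have "\<dots> \<le> infsum E UNIV" 
      by (rule infsum_mono_neutral) (auto intro: nonneg_summable_on_complete)
    also have "\<dots> = W" by (simp add: W_def wiener_norm_def E_def[abs_def])
    finally show ?thesis .
  qed
  have Efin: "E k < \<infinity>" for k using EF[of "{k}"] W by (auto intro: le_less_trans)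
  define q where "q k = enn2real (E k)" for k
  have Eq: "E k = ennreal (q k)" for k
    using Efin by (simp add: q_def less_top)
  have q0: "0 \<le> q k" for k by (simp add: q_def)
  have "q summable_on UNIV"
  proof (rule nonneg_bdd_above_summable_on[OF q0])
    have "sum q F \<le> enn2real W" if "finite F" for F
    proof -
      have "ennreal (sum q F) \<le> W" using EF[OF that] q0 by (simp add: Eq sum_ennreal)
      also have "W = ennreal (enn2real W)" using W by (simp add: less_top)
      finally show ?thesis by simp
    qed
    then show "bdd_above (sum q ` {F. F \<subseteq> UNIV \<and> finite F})" by (auto intro!: bdd_aboveI)
  qed
  moreover have "cmod (G t) \<le> q \<lfloor>t\<rfloor>" for t
  proof -
    let ?k = "\<lfloor>t\<rfloor>"
    let ?S = "{real_of_int ?k<..<real_of_int ?k + 1}"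
    let ?C = "{x. cmod (G x) \<le> q ?k}"
    have C: "closed ?C" by (intro closed_Collect_le continuous_intros cont)
    have "AE x in lebesgue_on ?S. ennreal (cmod (G x)) \<le> E ?k"
      unfolding E_def Lp_norm_def by (simp add: esssup_AE)
    then have ae: "AE x \<in> ?S in lebesgue. x \<in> ?C"
      by (simp add: AE_restrict_space_iff Eq q0)
    have "?S \<subseteq> ?C" 
      by (rule subsetI) (rule mem_closed_if_AE_lebesgue_open[OF _ C ae], auto)
    then have "closure ?S \<subseteq> ?C" using C by (rule closure_minimal)
    then show ?thesis by (auto simp: subset_iff)
  qed
  ultimately show thesis using q0 that by blast
qed

lemma summable_small_tail:
  fixes r :: "int \<Rightarrow> real"
  assumes r: "r summable_on UNIV" "\<And>l. 0 \<le> r l" and e: "0 < e"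
  obtains L :: nat where "\<And>F. finite F \<Longrightarrow> F \<inter> {- int L..int L} = {} \<Longrightarrow> sum r F \<le> e"
proof -
  obtain X where X: "finite X" "dist (sum r X) (infsum r UNIV) \<le> e"
    using infsum_finite_approximation[OF r(1) e] by blast
  define L where "L = nat (Max (insert 0 (abs ` X)))"
  have XL: "X \<subseteq> {- int L..int L}"
  proof
    fix l assume "l \<in> X"
    then have "\<bar>l\<bar> \<le> Max (insert 0 (abs ` X))" using X by (intro Max_ge) auto
    then show "l \<in> {- int L..int L}" by (auto simp: L_def)
  qed
  have "sum r F \<le> e" if F: "finite F" "F \<inter> {- int L..int L} = {}" for F
  proof -
    have "sum r X + sum r F = sum r (X \<union> F)"
      using X F XL by (intro sum.union_disjoint[symmetric]) auto
    also have "\<dots> \<le> infsum r UNIV" using X F r by (intro finite_sum_le_infsum) auto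
    finally show ?thesis using X by (auto simp: dist_real_def)
  qed
  then show thesis using that by blast
qed

text \<open>
  The kernel \<open>\<kappa>\<close> dominates both errors of the localization: the first term comes from moving a tent function of
  slope \<open>1 / N\<close> out of the series, the second from moving the point of evaluation by \<open>s\<close>. Outside a
  large window both are bounded by local suprema of \<open>G\<close>, whose tail is small. On the
  window, finitely many cells each receive the same small value \<open>\<epsilon>\<close>: a large \<open>N\<close> makes the first
  term small and uniform continuity of \<open>G\<close> the second.
\<close>

lemma small_perturbation_kernel:
  assumes G: "G \<in> wiener_amalgam" and cont: "continuous_on UNIV G" and \<eta>: "0 < \<eta>"
  obtains \<kappa> :: "int \<Rightarrow> real" and N :: nat and \<delta> :: real where
    "\<And>l. 0 \<le> \<kappa> l" "\<And>F. finite F \<Longrightarrow> sum \<kappa> F \<le> \<eta>" "0 < N" "0 < \<delta>" "\<delta> \<le> 1"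
    "\<And>t s. 0 \<le> s \<Longrightarrow> s \<le> \<delta> \<Longrightarrow>
       cmod (G t) * min 1 (\<bar>t\<bar> / real N) + cmod (G (t + s) - G t) \<le> \<kappa> \<lfloor>t\<rfloor>"
proof -
  obtain q :: "int \<Rightarrow> real" where q: "\<And>l. 0 \<le> q l" "q summable_on UNIV" "\<And>t. cmod (G t) \<le> q \<lfloor>t\<rfloor>"
    using wiener_majorant[OF G cont] by blast
  have q_le: "q l \<le> infsum q UNIV" for l
    using finite_sum_le_infsum[OF q(2), of "{l}"] q(1) by simp
  define Q where "Q = infsum q UNIV"
  have Q0: "0 \<le> Q" unfolding Q_def by (rule infsum_nonneg) (rule q)
  \<comment> \<open>one \<open>q l\<close> for the first error, and \<open>2 * q l + q (l + 1)\<close> for the second, as \<open>t + s\<close> may lie in the next cell\<close>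
  define r where "r l = 3 * q l + q (l + 1)" for l
  have r0: "0 \<le> r l" for l using q(1) by (simp add: r_def)
  have shift: "(\<lambda>l. q (l + 1)) summable_on UNIV"
    using summable_on_reindex_bij_betw[of "\<lambda>l. l + 1" UNIV UNIV q] q(2)
    by (simp add: bij_plus_right)
  have rs: "r summable_on UNIV"
    unfolding r_def by (intro summable_on_add summable_on_cmult_right q shift)
  obtain L :: nat where L: "\<And>F. finite F \<Longrightarrow> F \<inter> {- int L..int L} = {} \<Longrightarrow> sum r F \<le> \<eta> / 2"
    using summable_small_tail[OF rs r0, of "\<eta> / 2"] \<eta> by auto
  define \<epsilon> where "\<epsilon> = \<eta> / (2 * (2 * real L + 1))"
  have \<epsilon>: "0 < \<epsilon>" using \<eta> by (simp add: \<epsilon>_def)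
  define \<kappa> where "\<kappa> l = (if l \<in> {- int L..int L} then \<epsilon> else r l)" for l
  obtain N :: nat where N: "2 * Q * (L + 1) / \<epsilon> < N" using reals_Archimedean2 by blast
  have N0: "0 < N" using N Q0 \<epsilon> by (metis add_nonneg_nonneg divide_nonneg_pos gr0I less_irrefl
        mult_nonneg_nonneg not_le of_nat_0 of_nat_0_le_iff zero_le_numeral zero_le_one)
  let ?K = "{- real L - 1..real L + 2}"
  have "uniformly_continuous_on ?K G"
    by (intro compact_uniformly_continuous continuous_on_subset[OF cont]) auto
  then obtain d where d: "0 < d" "\<And>x y. x \<in> ?K \<Longrightarrow> y \<in> ?K \<Longrightarrow> dist y x < d \<Longrightarrow> dist (G y) (G x) < \<epsilon> / 2"
    using \<epsilon> unfolding uniformly_continuous_on_def by (metis half_gt_zero)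
  define \<delta> where "\<delta> = min 1 (d / 2)"
  have \<delta>: "0 < \<delta>" "\<delta> \<le> 1" "\<delta> < d" using d by (auto simp: \<delta>_def)
  show thesis
  proof (rule that[OF _ _ N0 \<delta>(1,2)])
    show "0 \<le> \<kappa> l" for l using \<epsilon> r0 by (simp add: \<kappa>_def)
    show "sum \<kappa> F \<le> \<eta>" if F: "finite F" for F
    proof -
      have "sum \<kappa> F = sum \<kappa> (F \<inter> {- int L..int L}) + sum \<kappa> (F - {- int L..int L})"
        using F by (rule sum.Int_Diff)
      also have "sum \<kappa> (F - {- int L..int L}) = sum r (F - {- int L..int L})"
        by (intro sum.cong) (auto simp: \<kappa>_def)
      also have "\<dots> \<le> \<eta> / 2" using F by (intro L) auto
      also have "sum \<kappa> (F \<inter> {- int L..int L}) = real (card (F \<inter> {- int L..int L})) * \<epsilon>"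
        by (simp add: \<kappa>_def)
      also have "\<dots> \<le> real (card {- int L..int L}) * \<epsilon>"
        using \<epsilon> by (intro mult_right_mono of_nat_mono card_mono) auto
      also have "\<dots> = \<eta> / 2" by (simp add: \<epsilon>_def field_simps)
      finally show ?thesis by simp
    qed
    fix t s :: real assume s: "0 \<le> s" "s \<le> \<delta>"
    show "cmod (G t) * min 1 (\<bar>t\<bar> / real N) + cmod (G (t + s) - G t) \<le> \<kappa> \<lfloor>t\<rfloor>"
    proof (cases "\<lfloor>t\<rfloor> \<in> {- int L..int L}")
      case True
      then have t: "- real L \<le> t" "t \<le> real L + 1" by (simp_all add: le_floor_iff floor_le_iff)
      have "cmod (G t) \<le> Q" using q(3)[of t] q_le[of "\<lfloor>t\<rfloor>"] by (simp add: Q_def)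
      then have "cmod (G t) * min 1 (\<bar>t\<bar> / real N) \<le> Q * ((L + 1) / real N)"
        using t N0 Q0 by (intro mult_mono min.coboundedI2 divide_right_mono) auto
      also have "\<dots> \<le> \<epsilon> / 2" using N \<epsilon> N0 by (simp add: field_simps)
      finally have "cmod (G t) * min 1 (\<bar>t\<bar> / real N) \<le> \<epsilon> / 2" .
      moreover have "cmod (G (t + s) - G t) < \<epsilon> / 2"
        using d(2)[of t "t + s"] t s \<delta> by (simp add: dist_norm)
      ultimately show ?thesis using True by (simp add: \<kappa>_def)
    next
      case False
      have "cmod (G t) * min 1 (\<bar>t\<bar> / real N) \<le> q \<lfloor>t\<rfloor>"
        using mult_left_le[of "min 1 (\<bar>t\<bar> / real N)" "cmod (G t)"] q(3)[of t] by simp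
      moreover have "cmod (G (t + s) - G t) \<le> cmod (G (t + s)) + cmod (G t)"
        by (rule norm_triangle_ineq4)
      moreover have "cmod (G (t + s)) \<le> q \<lfloor>t\<rfloor> + q (\<lfloor>t\<rfloor> + 1)"
      proof -
        have "\<lfloor>t + s\<rfloor> = \<lfloor>t\<rfloor> \<or> \<lfloor>t + s\<rfloor> = \<lfloor>t\<rfloor> + 1" using s \<delta> by linarith
        then show ?thesis using q(3)[of "t + s"] q(1)[of "\<lfloor>t\<rfloor>"] q(1)[of "\<lfloor>t\<rfloor> + 1"] by auto
      qed
      moreover have "\<kappa> \<lfloor>t\<rfloor> = 3 * q \<lfloor>t\<rfloor> + q (\<lfloor>t\<rfloor> + 1)" using False by (auto simp: \<kappa>_def r_def)
      ultimately show ?thesis using q(3)[of t] by simp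
    qed
  qed
qed

section \<open>Separated sets and block maxima\<close>

text \<open>
  The form in which separation enters the estimates: at most \<open>M\<close> points per unit length, uniformly.
\<close>

definition unit_counts_le :: "nat \<Rightarrow> real set \<Rightarrow> bool" where
  "unit_counts_le M \<Gamma> \<longleftrightarrow>
     (\<forall>x n. n > 0 \<longrightarrow> finite (\<Gamma> \<inter> {x..x + real n}) \<and> card (\<Gamma> \<inter> {x..x + real n}) \<le> M * n)"

lemma unit_counts_leD:
  assumes "unit_counts_le M \<Gamma>" "n > 0"
  shows "finite (\<Gamma> \<inter> {x..x + real n})" "card (\<Gamma> \<inter> {x..x + real n}) \<le> M * n"
  using assms by (simp_all add: unit_counts_le_def)

text \<open>
  If \<open>m\<close> exceeds the reciprocal of the separation, the map sending \<open>t\<close> to the floor of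
  \<open>m * (t - x)\<close> is injective on the set, and it sends an interval of length \<open>n\<close> to \<open>m * n + 1\<close> integers.
\<close>

lemma separated_imp_unit_counts_le:
  assumes "separated_set \<Gamma>"
  obtains M where "M > 0" "unit_counts_le M \<Gamma>"
proof -
  define e where "e = (INF (s, t)\<in>{(s, t). s \<in> \<Gamma> \<and> t \<in> \<Gamma> \<and> s \<noteq> t}. ennreal \<bar>s - t\<bar>)"
  have e: "e > 0" using assms by (simp add: separated_set_def e_def)
  define d where "d = enn2real (min e 1)"
  have d_eq: "ennreal d = min e 1"
    unfolding d_def by (rule ennreal_enn2real) (auto simp: min_def less_top intro: le_less_trans)
  have d0: "d > 0"
    using e d_eq by (metis ennreal_less_zero_iff less_numeral_extra(1) min_less_iff_conj)
  have sep: "d \<le> \<bar>s - t\<bar>" if "s \<in> \<Gamma>" "t \<in> \<Gamma>" "s \<noteq> t" for s t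
  proof -
    have "ennreal d \<le> e" by (simp add: d_eq)
    also have "e \<le> ennreal \<bar>s - t\<bar>"
      unfolding e_def by (rule INF_lower2[of "(s, t)"]) (use that in auto)
    finally show ?thesis by simp
  qed
  obtain m :: nat where m: "1 / d < m" using reals_Archimedean2 by blast
  have m0: "m > 0" using m d0 by (cases m) auto
  have md: "1 < real m * d" using m d0 by (simp add: field_simps)
  have "finite (\<Gamma> \<inter> {x..x + real n}) \<and> card (\<Gamma> \<inter> {x..x + real n}) \<le> (m + 1) * n" if n: "n > 0" for x n
  proof -
    let ?f = "\<lambda>t. nat \<lfloor>real m * (t - x)\<rfloor>"
    have "inj_on ?f (\<Gamma> \<inter> {x..x + real n})"
    proof (rule inj_onI, rule ccontr)
      fix s t assume s: "s \<in> \<Gamma> \<inter> {x..x + real n}" and t: "t \<in> \<Gamma> \<inter> {x..x + real n}"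
        and eq: "?f s = ?f t" and ne: "s \<noteq> t"
      have "0 \<le> real m * (s - x)" "0 \<le> real m * (t - x)" using s t by auto
      then have "\<lfloor>real m * (s - x)\<rfloor> = \<lfloor>real m * (t - x)\<rfloor>"
        using eq by (subst (asm) eq_nat_nat_iff) auto
      then have "\<bar>real m * (s - x) - real m * (t - x)\<bar> < 1" by linarith
      then have "real m * \<bar>s - t\<bar> < 1"
        by (simp add: abs_mult flip: right_diff_distrib)
      moreover have "real m * d \<le> real m * \<bar>s - t\<bar>"
        using sep[of s t] s t ne by (intro mult_left_mono) auto
      ultimately show False using md by simp
    qed
    moreover have "?f ` (\<Gamma> \<inter> {x..x + real n}) \<subseteq> {..m * n}"
    proof safe
      fix t assume "t \<in> {x..x + real n}"
      then have "real m * (t - x) \<le> real m * real n" by (intro mult_left_mono) auto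
      then have "\<lfloor>real m * (t - x)\<rfloor> \<le> int (m * n)" by (simp add: floor_le_iff)
      then show "?f t \<le> m * n" by linarith
    qed
    ultimately have "finite (\<Gamma> \<inter> {x..x + real n})" "card (\<Gamma> \<inter> {x..x + real n}) \<le> card {..m * n}"
      using inj_on_finite card_inj_on_le by blast+
    moreover have "m * n + 1 \<le> (m + 1) * n" using n by simp
    ultimately show ?thesis by simp
  qed
  then show thesis by (intro that[of "m + 1"]) (auto simp: unit_counts_le_def)
qed

text \<open>
  The points with a given value of \<open>\<lfloor>x - \<gamma>\<rfloor>\<close> lie in an interval of length one, so each value of
  the kernel is used at most \<open>M\<close> times.
\<close>

lemma sum_kernel_le:
  fixes \<kappa> :: "int \<Rightarrow> real"
  assumes \<Gamma>: "unit_counts_le M \<Gamma>" and F: "finite F" "F \<subseteq> \<Gamma>" and J: "finite J"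
    and sub: "\<And>\<gamma>. \<gamma> \<in> F \<Longrightarrow> \<lfloor>x - \<gamma>\<rfloor> \<in> J" and \<kappa>: "\<And>l. 0 \<le> \<kappa> l"
  shows "(\<Sum>\<gamma>\<in>F. \<kappa> \<lfloor>x - \<gamma>\<rfloor>) \<le> real M * sum \<kappa> J"
proof -
  have "(\<Sum>\<gamma>\<in>F. \<kappa> \<lfloor>x - \<gamma>\<rfloor>) = (\<Sum>l\<in>J. \<Sum>\<gamma>\<in>{\<gamma>\<in>F. \<lfloor>x - \<gamma>\<rfloor> = l}. \<kappa> \<lfloor>x - \<gamma>\<rfloor>)"
    by (rule sum.group[symmetric]) (use F J sub in auto)
  also have "\<dots> = (\<Sum>l\<in>J. real (card {\<gamma>\<in>F. \<lfloor>x - \<gamma>\<rfloor> = l}) * \<kappa> l)"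
    by (intro sum.cong refl) simp
  also have "\<dots> \<le> (\<Sum>l\<in>J. real M * \<kappa> l)"
  proof (intro sum_mono mult_right_mono \<kappa>)
    fix l
    let ?I = "{x - of_int l - 1..x - of_int l - 1 + real 1}"
    have *: "finite (\<Gamma> \<inter> ?I)" "card (\<Gamma> \<inter> ?I) \<le> M * 1"
      by (rule unit_counts_leD[OF \<Gamma>, of 1], simp)+
    have "{\<gamma>\<in>F. \<lfloor>x - \<gamma>\<rfloor> = l} \<subseteq> \<Gamma> \<inter> ?I"
      using F by (auto simp: floor_eq_iff)
    from card_mono[OF *(1) this] *(2) show "real (card {\<gamma>\<in>F. \<lfloor>x - \<gamma>\<rfloor> = l}) \<le> real M" by simp
  qed
  finally show ?thesis by (simp add: sum_distrib_left)
qed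

definition in_block :: "real set \<Rightarrow> nat \<Rightarrow> int \<Rightarrow> real set" where
  "in_block \<Gamma> N j = {\<gamma>\<in>\<Gamma>. \<lfloor>\<gamma> / real N\<rfloor> = j}"

lemma in_block_bounds:
  assumes "N > 0" "\<lfloor>\<gamma> / real N\<rfloor> = j"
  shows "of_int j * real N \<le> \<gamma>" "\<gamma> < (of_int j + 1) * real N"
  using assms by (auto simp: floor_eq_iff field_simps)

lemma in_block_finite:
  assumes "unit_counts_le M \<Gamma>" "N > 0"
  shows "finite (in_block \<Gamma> N j)" "card (in_block \<Gamma> N j) \<le> M * N"
proof -
  let ?I = "{of_int j * real N..of_int j * real N + real N}"
  have *: "finite (\<Gamma> \<inter> ?I)" "card (\<Gamma> \<inter> ?I) \<le> M * N"
    by (rule unit_counts_leD[OF assms])+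
  have sub: "in_block \<Gamma> N j \<subseteq> \<Gamma> \<inter> ?I"
  proof
    fix \<gamma> assume "\<gamma> \<in> in_block \<Gamma> N j"
    then have "\<gamma> \<in> \<Gamma>" "\<lfloor>\<gamma> / real N\<rfloor> = j" by (auto simp: in_block_def)
    then show "\<gamma> \<in> \<Gamma> \<inter> ?I"
      using in_block_bounds[OF \<open>N > 0\<close>, of \<gamma> j] by (simp add: algebra_simps)
  qed
  show "finite (in_block \<Gamma> N j)" using finite_subset[OF sub *(1)] .
  show "card (in_block \<Gamma> N j) \<le> M * N" using card_mono[OF *(1) sub] *(2) by simp
qed

text \<open>
  The maximum of the coefficients over one block; inserting \<open>0\<close> gives blocks without points of \<open>\<Gamma>\<close>
  the value \<open>0\<close>.
\<close>

definition block_max :: "real set \<Rightarrow> nat \<Rightarrow> (real \<Rightarrow> complex) \<Rightarrow> int \<Rightarrow> real" where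
  "block_max \<Gamma> N c j = Max (insert 0 ((\<lambda>\<gamma>. cmod (c \<gamma>)) ` in_block \<Gamma> N j))"

lemma block_max:
  assumes "unit_counts_le M \<Gamma>" "N > 0"
  shows block_max_nonneg: "0 \<le> block_max \<Gamma> N c j"
    and norm_le_block_max: "\<gamma> \<in> \<Gamma> \<Longrightarrow> cmod (c \<gamma>) \<le> block_max \<Gamma> N c \<lfloor>\<gamma> / real N\<rfloor>"
    and block_max_attained: "block_max \<Gamma> N c j = 0 \<or> (\<exists>\<gamma>\<in>in_block \<Gamma> N j. block_max \<Gamma> N c j = cmod (c \<gamma>))"
proof -
  let ?B = "\<lambda>j. insert 0 ((\<lambda>\<gamma>. cmod (c \<gamma>)) ` in_block \<Gamma> N j)"
  have fin: "finite (?B j)" for j using in_block_finite[OF assms] by simp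
  show "0 \<le> block_max \<Gamma> N c j" unfolding block_max_def by (rule Max_ge[OF fin]) simp
  show "cmod (c \<gamma>) \<le> block_max \<Gamma> N c \<lfloor>\<gamma> / real N\<rfloor>" if "\<gamma> \<in> \<Gamma>"
    unfolding block_max_def by (rule Max_ge[OF fin]) (use that in \<open>simp add: in_block_def\<close>)
  have "block_max \<Gamma> N c j \<in> ?B j" unfolding block_max_def by (rule Max_in[OF fin]) simp
  then show "block_max \<Gamma> N c j = 0 \<or> (\<exists>\<gamma>\<in>in_block \<Gamma> N j. block_max \<Gamma> N c j = cmod (c \<gamma>))"
    by auto
qed

lemma sum_block_max_powr_le:
  assumes \<Gamma>: "unit_counts_le M \<Gamma>" "N > 0" and p: "p > 0"
    and E: "\<And>F. finite F \<Longrightarrow> F \<subseteq> \<Gamma> \<Longrightarrow> (\<Sum>\<gamma>\<in>F. cmod (c \<gamma>) powr p) \<le> E"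
    and I: "finite I"
  shows "(\<Sum>j\<in>I. block_max \<Gamma> N c j powr p) \<le> E"
proof -
  have "(\<Sum>j\<in>I. block_max \<Gamma> N c j powr p) \<le> (\<Sum>j\<in>I. \<Sum>\<gamma>\<in>in_block \<Gamma> N j. cmod (c \<gamma>) powr p)"
  proof (rule sum_mono)
    fix j
    from block_max_attained[OF \<Gamma>, of c j]
    show "block_max \<Gamma> N c j powr p \<le> (\<Sum>\<gamma>\<in>in_block \<Gamma> N j. cmod (c \<gamma>) powr p)"
    proof
      assume "\<exists>\<gamma>\<in>in_block \<Gamma> N j. block_max \<Gamma> N c j = cmod (c \<gamma>)"
      then obtain \<gamma> where "\<gamma> \<in> in_block \<Gamma> N j" "block_max \<Gamma> N c j = cmod (c \<gamma>)" by blast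
      then show ?thesis
        using in_block_finite[OF \<Gamma>] by (auto intro: member_le_sum)
    qed (simp add: sum_nonneg)
  qed
  also have "\<dots> = (\<Sum>\<gamma>\<in>(\<Union>j\<in>I. in_block \<Gamma> N j). cmod (c \<gamma>) powr p)"
    by (rule sum.UNION_disjoint[symmetric])
       (use I in_block_finite[OF \<Gamma>] in \<open>auto simp: in_block_def\<close>)
  also have "\<dots> \<le> E"
    by (rule E) (use I in_block_finite[OF \<Gamma>] in \<open>auto simp: in_block_def\<close>)
  finally show ?thesis .
qed

lemma sum_powr_le_block_max:
  assumes \<Gamma>: "unit_counts_le M \<Gamma>" "N > 0" and p: "p > 0"
    and E: "\<And>I. finite I \<Longrightarrow> (\<Sum>j\<in>I. block_max \<Gamma> N c j powr p) \<le> E"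
    and F: "finite F" "F \<subseteq> \<Gamma>"
  shows "(\<Sum>\<gamma>\<in>F. cmod (c \<gamma>) powr p) \<le> real (M * N) * E"
proof -
  define I where "I = (\<lambda>\<gamma>. \<lfloor>\<gamma> / real N\<rfloor>) ` F"
  have I: "finite I" using F by (simp add: I_def)
  have "(\<Sum>\<gamma>\<in>F. cmod (c \<gamma>) powr p) = (\<Sum>j\<in>I. \<Sum>\<gamma>\<in>{\<gamma>\<in>F. \<lfloor>\<gamma> / real N\<rfloor> = j}. cmod (c \<gamma>) powr p)"
    unfolding I_def by (rule sum.image_gen[OF F(1)])
  also have "\<dots> \<le> (\<Sum>j\<in>I. real (M * N) * block_max \<Gamma> N c j powr p)"
  proof (rule sum_mono)
    fix j
    have "(\<Sum>\<gamma>\<in>{\<gamma>\<in>F. \<lfloor>\<gamma> / real N\<rfloor> = j}. cmod (c \<gamma>) powr p)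
        \<le> real (card {\<gamma>\<in>F. \<lfloor>\<gamma> / real N\<rfloor> = j}) * block_max \<Gamma> N c j powr p"
      using F norm_le_block_max[OF \<Gamma>] p by (intro sum_bounded_above powr_mono2) auto
    also have "real (card {\<gamma>\<in>F. \<lfloor>\<gamma> / real N\<rfloor> = j}) \<le> real (card (in_block \<Gamma> N j))"
      using in_block_finite(1)[OF \<Gamma>] F by (intro of_nat_mono card_mono) (auto simp: in_block_def)
    also have "\<dots> \<le> real (M * N)" using in_block_finite(2)[OF \<Gamma>] by (intro of_nat_mono)
    finally show "(\<Sum>\<gamma>\<in>{\<gamma>\<in>F. \<lfloor>\<gamma> / real N\<rfloor> = j}. cmod (c \<gamma>) powr p)
        \<le> real (M * N) * block_max \<Gamma> N c j powr p" by (simp add: mult_right_mono)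
  qed
  also have "\<dots> \<le> real (M * N) * E"
    unfolding sum_distrib_left[symmetric] by (intro mult_left_mono E I) simp
  finally show ?thesis .
qed

section \<open>Localizing the stability inequality\<close>

lemma norm_infsum_le_finite_bound:
  fixes f :: "'i \<Rightarrow> complex"
  assumes "\<And>F. finite F \<Longrightarrow> F \<subseteq> A \<Longrightarrow> (\<Sum>i\<in>F. cmod (f i)) \<le> B"
  shows "f summable_on A" "cmod (infsum f A) \<le> B"
proof -
  have abs: "(\<lambda>i. cmod (f i)) summable_on A"
    by (rule nonneg_bdd_above_summable_on) (use assms in \<open>auto intro!: bdd_aboveI\<close>)
  then show "f summable_on A" by (rule abs_summable_summable)
  have "cmod (infsum f A) \<le> infsum (\<lambda>i. cmod (f i)) A" by (rule norm_infsum_bound[OF abs])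
  also have "\<dots> \<le> B" by (rule infsum_le_finite_sums[OF abs]) (use assms in auto)
  finally show "cmod (infsum f A) \<le> B" .
qed

lemma shift_series_summable:
  fixes q :: "int \<Rightarrow> real"
  assumes \<Gamma>: "unit_counts_le M \<Gamma>" and q: "\<And>l. 0 \<le> q l" "q summable_on UNIV" "\<And>t. cmod (G t) \<le> q \<lfloor>t\<rfloor>"
    and c: "\<And>\<gamma>. \<gamma> \<in> \<Gamma> \<Longrightarrow> cmod (c \<gamma>) \<le> B"
  shows "(\<lambda>\<gamma>. c \<gamma> * G (x - \<gamma>)) summable_on \<Gamma>"
proof (rule norm_infsum_le_finite_bound(1))
  fix F assume F: "finite F" "F \<subseteq> \<Gamma>"
  have "(\<Sum>\<gamma>\<in>F. cmod (c \<gamma> * G (x - \<gamma>))) \<le> (\<Sum>\<gamma>\<in>F. \<bar>B\<bar> * q \<lfloor>x - \<gamma>\<rfloor>)"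
    using F by (intro sum_mono) (auto simp: norm_mult intro!: mult_mono q order.trans[OF c abs_ge_self])
  also have "\<dots> = \<bar>B\<bar> * (\<Sum>\<gamma>\<in>F. q \<lfloor>x - \<gamma>\<rfloor>)" by (simp add: sum_distrib_left)
  also have "(\<Sum>\<gamma>\<in>F. q \<lfloor>x - \<gamma>\<rfloor>) \<le> real M * sum q ((\<lambda>\<gamma>. \<lfloor>x - \<gamma>\<rfloor>) ` F)"
    using F q by (intro sum_kernel_le[OF \<Gamma>]) auto
  also have "sum q ((\<lambda>\<gamma>. \<lfloor>x - \<gamma>\<rfloor>) ` F) \<le> infsum q UNIV"
    using F q by (intro finite_sum_le_infsum) auto
  finally show "(\<Sum>\<gamma>\<in>F. cmod (c \<gamma> * G (x - \<gamma>))) \<le> \<bar>B\<bar> * (real M * infsum q UNIV)"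
    by (simp add: mult_left_mono)
qed

text \<open>
  The cutoff for block \<open>k\<close>: it equals \<open>1\<close> on the block, is supported in the blocks from \<open>k - 2\<close> to \<open>k + 1\<close>, and
  has slope \<open>1 / N\<close>.
\<close>

definition tent :: "nat \<Rightarrow> int \<Rightarrow> real \<Rightarrow> real" where
  "tent N k x = max 0 (min 1 (2 - \<bar>x / real N - of_int k\<bar>))"

lemma tent_range: "0 \<le> tent N k x" "tent N k x \<le> 1"
  by (auto simp: tent_def)

lemma tent_diff_le:
  assumes "N > 0"
  shows "\<bar>tent N k x - tent N k y\<bar> \<le> min 1 (\<bar>x - y\<bar> / real N)"
proof -
  have "\<bar>x / real N - y / real N\<bar> = \<bar>x - y\<bar> / real N"
    using assms by (simp add: abs_divide flip: diff_divide_distrib)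
  then show ?thesis unfolding tent_def by linarith
qed

lemma tent_eq_1: "N > 0 \<Longrightarrow> \<lfloor>x / real N\<rfloor> = k \<Longrightarrow> tent N k x = 1"
  unfolding tent_def by linarith

lemma tent_nonzero:
  assumes "N > 0" "tent N k x \<noteq> 0"
  shows "(of_int k - 2) * real N < x" "x < (of_int k + 2) * real N" "\<lfloor>x / real N\<rfloor> - k \<in> {-2..1}"
proof -
  have *: "\<bar>x / real N - of_int k\<bar> < 2" using assms(2) by (auto simp: tent_def max_def split: if_splits)
  then have "of_int k - 2 < x / real N" "x / real N < of_int k + 2" by linarith+
  then show "(of_int k - 2) * real N < x" "x < (of_int k + 2) * real N"
    using assms(1) by (simp_all add: field_simps)
  show "\<lfloor>x / real N\<rfloor> - k \<in> {-2..1}" using * unfolding atLeastAtMost_iff by linarith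
qed

text \<open>
  A bound for the interaction of a point near block \<open>k\<close> with the coefficients in block \<open>k + i\<close>, uniform
  in \<open>k\<close>. If the point \<open>x\<close> lies in the support of the tent of block \<open>k\<close>, the differences \<open>x - \<gamma>\<close> have their
  floors in the displayed interval of integers. If \<open>x\<close> is arbitrary, only the blocks that meet
  the support of the tent matter, and for them the total mass \<open>\<eta>\<close> of \<open>\<kappa>\<close> is an adequate bound.
\<close>

definition block_kernel :: "nat \<Rightarrow> nat \<Rightarrow> (int \<Rightarrow> real) \<Rightarrow> real \<Rightarrow> int \<Rightarrow> real" where
  "block_kernel M N \<kappa> \<eta> i =
     real M * (sum \<kappa> {- (i + 4) * int N..<(3 - i) * int N} + (if i \<in> {-2..1} then \<eta> else 0))"

text \<open>
  Each integer lies in at most seven of the intervals of the definition, and the summand \<open>\<eta>\<close>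
  occurs for four indices; hence \<open>11 = 7 + 4\<close>, whatever the block length.
\<close>

lemma block_kernel:
  assumes \<kappa>: "\<And>l. 0 \<le> \<kappa> l" "\<And>F. finite F \<Longrightarrow> sum \<kappa> F \<le> \<eta>" and N: "N > 0"
  shows block_kernel_nonneg: "0 \<le> block_kernel M N \<kappa> \<eta> i"
    and block_kernel_summable: "block_kernel M N \<kappa> \<eta> summable_on UNIV"
    and block_kernel_infsum: "infsum (block_kernel M N \<kappa> \<eta>) UNIV \<le> 11 * real M * \<eta>"
proof -
  have \<eta>: "0 \<le> \<eta>" using \<kappa>(2)[of "{}"] by simp
  show nn: "0 \<le> block_kernel M N \<kappa> \<eta> i" for i
    using \<kappa>(1) \<eta> by (auto simp: block_kernel_def intro!: mult_nonneg_nonneg add_nonneg_nonneg sum_nonneg)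
  have fin: "sum (block_kernel M N \<kappa> \<eta>) I \<le> 11 * real M * \<eta>" if I: "finite I" for I
  proof -
    let ?J = "\<lambda>i. {- (i + 4) * int N..<(3 - i) * int N}"
    let ?U = "\<Union>i\<in>I. ?J i"
    have U: "finite ?U" using I by auto
    have "(\<Sum>i\<in>I. sum \<kappa> (?J i)) = (\<Sum>i\<in>I. \<Sum>l\<in>{l. l \<in> ?U \<and> l \<in> ?J i}. \<kappa> l)"
      by (intro sum.cong) auto
    also have "\<dots> = (\<Sum>l\<in>?U. \<Sum>i\<in>{i. i \<in> I \<and> l \<in> ?J i}. \<kappa> l)"
      by (rule sum.swap_restrict[OF I U])
    also have "\<dots> \<le> (\<Sum>l\<in>?U. 7 * \<kappa> l)"
    proof (rule sum_mono)
      fix l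
      have "{i. i \<in> I \<and> l \<in> ?J i} \<subseteq> {-4 - l div int N..2 - l div int N}"
      proof
        fix i assume "i \<in> {i. i \<in> I \<and> l \<in> ?J i}"
        then have l: "- (i + 4) * int N \<le> l" "l < (3 - i) * int N" by auto
        have "- (i + 4) \<le> l div int N"
          using zdiv_mono1[OF l(1), of "int N"] N by simp
        moreover have "l div int N < 3 - i"
        proof -
          have "l div int N * int N \<le> l"
            using div_mult_mod_eq[of l "int N"] pos_mod_sign[of "int N" l] N by linarith
          then have "l div int N * int N < (3 - i) * int N" using l(2) by linarith
          then show ?thesis using N by simp
        qed
        ultimately show "i \<in> {-4 - l div int N..2 - l div int N}" by auto
      qed
      then have "card {i. i \<in> I \<and> l \<in> ?J i} \<le> card {-4 - l div int N..2 - l div int N}"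
        by (intro card_mono) auto
      also have "\<dots> = 7" by simp
      finally show "(\<Sum>i\<in>{i. i \<in> I \<and> l \<in> ?J i}. \<kappa> l) \<le> 7 * \<kappa> l"
        using \<kappa>(1) by (simp add: mult_right_mono)
    qed
    also have "\<dots> \<le> 7 * \<eta>" using \<kappa>(2)[OF U] by (simp flip: sum_distrib_left)
    finally have 1: "(\<Sum>i\<in>I. sum \<kappa> (?J i)) \<le> 7 * \<eta>" .
    have "(\<Sum>i\<in>I. if i \<in> {-2..1} then \<eta> else 0) = (\<Sum>i\<in>I \<inter> {-2..1}. \<eta>)"
      by (rule sum.inter_restrict[symmetric, OF I])
    also have "\<dots> \<le> (\<Sum>i\<in>{-2..1::int}. \<eta>)" using \<eta> by (intro sum_mono2) auto
    also have "\<dots> = 4 * \<eta>" by simp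
    finally have 2: "(\<Sum>i\<in>I. if i \<in> {-2..1} then \<eta> else 0) \<le> 4 * \<eta>" .
    have "sum (block_kernel M N \<kappa> \<eta>) I
        = real M * ((\<Sum>i\<in>I. sum \<kappa> (?J i)) + (\<Sum>i\<in>I. if i \<in> {-2..1} then \<eta> else 0))"
      by (simp only: block_kernel_def[abs_def] sum_distrib_left[symmetric] sum.distrib)
    also have "\<dots> \<le> real M * (7 * \<eta> + 4 * \<eta>)" by (intro mult_left_mono add_mono 1 2) simp
    finally show ?thesis by simp
  qed
  show s: "block_kernel M N \<kappa> \<eta> summable_on UNIV"
    by (rule nonneg_bdd_above_summable_on[OF nn]) (use fin in \<open>auto intro!: bdd_aboveI\<close>)
  show "infsum (block_kernel M N \<kappa> \<eta>) UNIV \<le> 11 * real M * \<eta>"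
    by (rule infsum_le_finite_sums[OF s fin])
qed

lemma sum_kernel_block_le:
  assumes \<Gamma>: "unit_counts_le M \<Gamma>" and \<kappa>: "\<And>l. 0 \<le> \<kappa> l" "\<And>F. finite F \<Longrightarrow> sum \<kappa> F \<le> \<eta>" and N: "N > 0"
    and F: "finite F" "F \<subseteq> \<Gamma>" and idx: "\<And>\<gamma>. \<gamma> \<in> F \<Longrightarrow> \<lfloor>\<gamma> / real N\<rfloor> = k + i"
    and loc: "((of_int k - 2) * real N < x \<and> x < (of_int k + 2) * real N) \<or> i \<in> {-2..1}"
  shows "(\<Sum>\<gamma>\<in>F. \<kappa> \<lfloor>x - \<gamma>\<rfloor>) \<le> block_kernel M N \<kappa> \<eta> i"
proof -
  have \<eta>: "0 \<le> \<eta>" using \<kappa>(2)[of "{}"] by simp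
  let ?J = "{- (i + 4) * int N..<(3 - i) * int N}"
  show ?thesis
  proof (cases "i \<in> {-2..1}")
    case True
    let ?L = "(\<lambda>\<gamma>. \<lfloor>x - \<gamma>\<rfloor>) ` F"
    have "(\<Sum>\<gamma>\<in>F. \<kappa> \<lfloor>x - \<gamma>\<rfloor>) \<le> real M * sum \<kappa> ?L"
      using F \<kappa> by (intro sum_kernel_le[OF \<Gamma>]) auto
    also have "\<dots> \<le> real M * \<eta>" using F \<kappa> by (intro mult_left_mono) auto
    also have "\<dots> \<le> block_kernel M N \<kappa> \<eta> i"
      using True \<kappa>(1) unfolding block_kernel_def by (intro mult_left_mono) (auto simp: sum_nonneg)
    finally show ?thesis .
  next
    case False
    with loc have x: "(of_int k - 2) * real N < x" "x < (of_int k + 2) * real N" by auto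
    have "(\<Sum>\<gamma>\<in>F. \<kappa> \<lfloor>x - \<gamma>\<rfloor>) \<le> real M * sum \<kappa> ?J"
    proof (rule sum_kernel_le[OF \<Gamma> F _ _ \<kappa>(1)])
      fix \<gamma> assume "\<gamma> \<in> F"
      from in_block_bounds[OF N idx[OF this]]
      have "of_int (k + i) * real N \<le> \<gamma>" "\<gamma> < (of_int (k + i) + 1) * real N" by auto
      moreover have "(of_int k - 2) * real N - (of_int (k + i) + 1) * real N = of_int (- (i + 3) * int N)"
        by (simp add: algebra_simps)
      moreover have "(of_int k + 2) * real N - of_int (k + i) * real N = of_int ((2 - i) * int N)"
        by (simp add: algebra_simps)
      ultimately have "of_int (- (i + 3) * int N) < x - \<gamma>" "x - \<gamma> < of_int ((2 - i) * int N)"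
        using x by linarith+
      then have "- (i + 3) * int N \<le> \<lfloor>x - \<gamma>\<rfloor>" "\<lfloor>x - \<gamma>\<rfloor> < (2 - i) * int N"
        by linarith+
      then show "\<lfloor>x - \<gamma>\<rfloor> \<in> ?J" using N by (auto simp: algebra_simps)
    qed auto
    then show ?thesis unfolding block_kernel_def if_not_P[OF False] by simp
  qed
qed

text \<open>
  Grouping the points of \<open>F\<close> by blocks. The alternative in the last hypothesis matches the two parts of
  \<open>block_kernel\<close>: either \<open>x\<close> is near block \<open>k\<close>, or all points of \<open>F\<close> are.
\<close>

lemma sum_kernel_coeff_le:
  assumes \<Gamma>: "unit_counts_le M \<Gamma>" and \<kappa>: "\<And>l. 0 \<le> \<kappa> l" "\<And>F. finite F \<Longrightarrow> sum \<kappa> F \<le> \<eta>" and N: "N > 0"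
    and sum: "(\<lambda>i. block_kernel M N \<kappa> \<eta> i * block_max \<Gamma> N c (k + i)) summable_on UNIV"
    and F: "finite F" "F \<subseteq> \<Gamma>"
    and loc: "tent N k x \<noteq> 0 \<or> (\<forall>\<gamma>\<in>F. tent N k \<gamma> \<noteq> 0)"
  shows "(\<Sum>\<gamma>\<in>F. \<kappa> \<lfloor>x - \<gamma>\<rfloor> * cmod (c \<gamma>))
           \<le> (\<Sum>\<^sub>\<infinity>i. block_kernel M N \<kappa> \<eta> i * block_max \<Gamma> N c (k + i))"
proof -
  let ?g = "\<lambda>\<gamma>. \<lfloor>\<gamma> / real N\<rfloor> - k"
  let ?I = "?g ` F"
  note a0 = block_max_nonneg[OF \<Gamma> N]
  have "(\<Sum>\<gamma>\<in>F. \<kappa> \<lfloor>x - \<gamma>\<rfloor> * cmod (c \<gamma>))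
      = (\<Sum>i\<in>?I. \<Sum>\<gamma>\<in>{\<gamma>\<in>F. ?g \<gamma> = i}. \<kappa> \<lfloor>x - \<gamma>\<rfloor> * cmod (c \<gamma>))"
    by (rule sum.image_gen[OF F(1)])
  also have "\<dots> \<le> (\<Sum>i\<in>?I. block_kernel M N \<kappa> \<eta> i * block_max \<Gamma> N c (k + i))"
  proof (rule sum_mono)
    fix i assume i: "i \<in> ?I"
    have "(\<Sum>\<gamma>\<in>{\<gamma>\<in>F. ?g \<gamma> = i}. \<kappa> \<lfloor>x - \<gamma>\<rfloor> * cmod (c \<gamma>))
        \<le> (\<Sum>\<gamma>\<in>{\<gamma>\<in>F. ?g \<gamma> = i}. \<kappa> \<lfloor>x - \<gamma>\<rfloor> * block_max \<Gamma> N c (k + i))"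
      using F norm_le_block_max[OF \<Gamma> N] by (intro sum_mono mult_left_mono \<kappa>(1)) force
    also have "\<dots> = (\<Sum>\<gamma>\<in>{\<gamma>\<in>F. ?g \<gamma> = i}. \<kappa> \<lfloor>x - \<gamma>\<rfloor>) * block_max \<Gamma> N c (k + i)"
      by (simp add: sum_distrib_right)
    also have "\<dots> \<le> block_kernel M N \<kappa> \<eta> i * block_max \<Gamma> N c (k + i)"
    proof (intro mult_right_mono a0 sum_kernel_block_le[OF \<Gamma> \<kappa> N])
      show "((of_int k - 2) * real N < x \<and> x < (of_int k + 2) * real N) \<or> i \<in> {-2..1}"
        using loc i tent_nonzero[OF N] by blast
    qed (use F in auto)
    finally show "(\<Sum>\<gamma>\<in>{\<gamma>\<in>F. ?g \<gamma> = i}. \<kappa> \<lfloor>x - \<gamma>\<rfloor> * cmod (c \<gamma>))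
        \<le> block_kernel M N \<kappa> \<eta> i * block_max \<Gamma> N c (k + i)" .
  qed
  also have "\<dots> \<le> (\<Sum>\<^sub>\<infinity>i. block_kernel M N \<kappa> \<eta> i * block_max \<Gamma> N c (k + i))"
    using F a0 block_kernel_nonneg[OF \<kappa> N] by (intro finite_sum_le_infsum sum) auto
  finally show ?thesis .
qed

text \<open>
  Commuting the tent function with the series. The supremum bound gives no information about the position of
  \<open>x\<close>, so both positions must be handled: if \<open>x\<close> lies in the support of the tent, all of \<open>\<Gamma>\<close>
  contributes to the error; otherwise the first term on the right vanishes and so do the error terms of all \<open>\<gamma>\<close> off the
  support. In both cases the error is bounded by the same convolution.
\<close>

lemma shift_series_tent_le:
  fixes c :: "real \<Rightarrow> complex"
  assumes \<Gamma>: "unit_counts_le M \<Gamma>" and \<kappa>: "\<And>l. 0 \<le> \<kappa> l" "\<And>F. finite F \<Longrightarrow> sum \<kappa> F \<le> \<eta>" and N: "N > 0"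
    and pert: "\<And>t. cmod (G t) * min 1 (\<bar>t\<bar> / real N) + cmod (G (t + s) - G t) \<le> \<kappa> \<lfloor>t\<rfloor>"
    and summable: "\<And>x. (\<lambda>\<gamma>. c \<gamma> * G (x - \<gamma>)) summable_on \<Gamma>"
    and sum: "(\<lambda>i. block_kernel M N \<kappa> \<eta> i * block_max \<Gamma> N c (k + i)) summable_on UNIV"
  shows "cmod (shift_series \<Gamma> G (\<lambda>\<gamma>. tent N k \<gamma> * c \<gamma>) x)
    \<le> tent N k x * cmod (shift_series \<Gamma> G c (x + s))
      + (\<Sum>\<^sub>\<infinity>i. block_kernel M N \<kappa> \<eta> i * block_max \<Gamma> N c (k + i))"
proof -
  let ?t = "tent N k"
  let ?Y = "\<Sum>\<^sub>\<infinity>i. block_kernel M N \<kappa> \<eta> i * block_max \<Gamma> N c (k + i)"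
  let ?h = "\<lambda>\<gamma>. c \<gamma> * (?t \<gamma> * G (x - \<gamma>) - ?t x * G (x + s - \<gamma>))"
  have term_le: "cmod (?h \<gamma>) \<le> \<kappa> \<lfloor>x - \<gamma>\<rfloor> * cmod (c \<gamma>)" for \<gamma>
  proof -
    have "?t \<gamma> * G (x - \<gamma>) - ?t x * G (x + s - \<gamma>)
        = of_real (?t \<gamma> - ?t x) * G (x - \<gamma>) - ?t x * (G (x - \<gamma> + s) - G (x - \<gamma>))"
      by (simp add: algebra_simps)
    then have "cmod (?t \<gamma> * G (x - \<gamma>) - ?t x * G (x + s - \<gamma>))
        \<le> cmod (of_real (?t \<gamma> - ?t x) * G (x - \<gamma>)) + cmod (?t x * (G (x - \<gamma> + s) - G (x - \<gamma>)))"
      by (metis norm_triangle_ineq4)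
    also have "\<dots> = \<bar>?t \<gamma> - ?t x\<bar> * cmod (G (x - \<gamma>)) + ?t x * cmod (G (x - \<gamma> + s) - G (x - \<gamma>))"
      by (simp add: norm_mult tent_range del: of_real_diff)
    also have "\<dots> \<le> min 1 (\<bar>x - \<gamma>\<bar> / real N) * cmod (G (x - \<gamma>)) + 1 * cmod (G (x - \<gamma> + s) - G (x - \<gamma>))"
      using tent_diff_le[OF N, of k \<gamma> x] tent_range(2)[of N k x]
      by (intro add_mono mult_right_mono) (auto simp: abs_minus_commute)
    also have "\<dots> \<le> \<kappa> \<lfloor>x - \<gamma>\<rfloor>" using pert[of "x - \<gamma>"] by (simp add: mult.commute)
    finally show ?thesis by (simp add: norm_mult mult.commute mult_left_mono)
  qed
  have fin: "(\<Sum>\<gamma>\<in>F. cmod (?h \<gamma>)) \<le> ?Y" if F: "finite F" "F \<subseteq> \<Gamma>" for F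
  proof -
    let ?F = "if ?t x = 0 then {\<gamma>\<in>F. ?t \<gamma> \<noteq> 0} else F"
    have "(\<Sum>\<gamma>\<in>F. cmod (?h \<gamma>)) = (\<Sum>\<gamma>\<in>?F. cmod (?h \<gamma>))"
      by (rule sum.mono_neutral_right) (use F in \<open>auto split: if_splits\<close>)
    also have "\<dots> \<le> (\<Sum>\<gamma>\<in>?F. \<kappa> \<lfloor>x - \<gamma>\<rfloor> * cmod (c \<gamma>))" by (intro sum_mono term_le)
    also have "\<dots> \<le> ?Y"
      by (rule sum_kernel_coeff_le[OF \<Gamma> \<kappa> N sum]) (use F in auto)
    finally show ?thesis .
  qed
  note h = norm_infsum_le_finite_bound[of \<Gamma> ?h, OF fin]
  have sF: "((\<lambda>\<gamma>. ?t x * (c \<gamma> * G (x + s - \<gamma>))) has_sum ?t x * shift_series \<Gamma> G c (x + s)) \<Gamma>"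
    unfolding shift_series_def by (intro has_sum_cmult_right has_sum_infsum summable)
  have "((\<lambda>\<gamma>. ?t x * (c \<gamma> * G (x + s - \<gamma>)) + ?h \<gamma>)
      has_sum (?t x * shift_series \<Gamma> G c (x + s) + infsum ?h \<Gamma>)) \<Gamma>"
    by (intro has_sum_add sF has_sum_infsum h(1))
  also have "(\<lambda>\<gamma>. ?t x * (c \<gamma> * G (x + s - \<gamma>)) + ?h \<gamma>) = (\<lambda>\<gamma>. ?t \<gamma> * c \<gamma> * G (x - \<gamma>))"
    by (simp add: algebra_simps)
  finally have "shift_series \<Gamma> G (\<lambda>\<gamma>. ?t \<gamma> * c \<gamma>) x = ?t x * shift_series \<Gamma> G c (x + s) + infsum ?h \<Gamma>"
    unfolding shift_series_def by (rule infsumI)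
  then have "cmod (shift_series \<Gamma> G (\<lambda>\<gamma>. ?t \<gamma> * c \<gamma>) x)
      \<le> cmod (?t x * shift_series \<Gamma> G c (x + s)) + cmod (infsum ?h \<Gamma>)"
    by (simp add: norm_triangle_ineq)
  also have "cmod (?t x * shift_series \<Gamma> G c (x + s)) = ?t x * cmod (shift_series \<Gamma> G c (x + s))"
    by (simp add: norm_mult tent_range)
  finally show ?thesis using h(2) by simp
qed

text \<open>
  A finitely supported sequence gives a continuous, hence measurable, series, so its essential supremum is
  bounded by any bound that holds everywhere. The factor \<open>1 / 2\<close> leaves room for the supremum not being attained.
\<close>

lemma sup_stability_attained:
  assumes stable: "\<forall>c \<in> lp_space \<infinity> \<Gamma>.
           ennreal C\<^sub>1 * lp_norm \<infinity> \<Gamma> c \<le> Lp_norm \<infinity> lebesgue (shift_series \<Gamma> G c)"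
    and C: "C\<^sub>1 > 0" and cont: "continuous_on UNIV G"
    and S: "finite S" "S \<subseteq> \<Gamma>" "\<And>\<gamma>. \<gamma> \<in> \<Gamma> - S \<Longrightarrow> c \<gamma> = 0" and \<gamma>: "\<gamma> \<in> S"
  shows "\<exists>x. C\<^sub>1 / 2 * cmod (c \<gamma>) \<le> cmod (shift_series \<Gamma> G c x)"
proof (cases "c \<gamma> = 0")
  case False
  let ?a = "cmod (c \<gamma>)"
  have a: "0 < ?a" using False by simp
  have series: "shift_series \<Gamma> G c = (\<lambda>x. \<Sum>\<gamma>\<in>S. c \<gamma> * G (x - \<gamma>))"
  proof
    fix x
    have "shift_series \<Gamma> G c x = (\<Sum>\<^sub>\<infinity>\<gamma>\<in>S. c \<gamma> * G (x - \<gamma>))"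
      unfolding shift_series_def by (rule infsum_cong_neutral) (use S in auto)
    then show "shift_series \<Gamma> G c x = (\<Sum>\<gamma>\<in>S. c \<gamma> * G (x - \<gamma>))" using S(1) by simp
  qed
  have "continuous_on UNIV (\<lambda>x. \<Sum>\<gamma>\<in>S. c \<gamma> * G (x - \<gamma>))"
    by (intro continuous_intros continuous_on_compose2[OF cont]) auto
  then have "shift_series \<Gamma> G c \<in> borel_measurable borel"
    unfolding series by (rule borel_measurable_continuous_onI)
  then have meas: "shift_series \<Gamma> G c \<in> borel_measurable lebesgue"
    by (intro measurable_completion) simp
  have "cmod (c t) \<le> (\<Sum>\<gamma>\<in>S. cmod (c \<gamma>))" if "t \<in> \<Gamma>" for t
  proof (cases "t \<in> S")
    case True
    then show ?thesis using S(1) by (intro member_le_sum) auto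
  next
    case False
    then show ?thesis using that S(3) by (simp add: sum_nonneg)
  qed
  then have "lp_norm \<infinity> \<Gamma> c \<le> ennreal (\<Sum>\<gamma>\<in>S. cmod (c \<gamma>))"
    unfolding Lp_norm_def by (auto intro!: esssup_I ennreal_leI simp: AE_count_space)
  then have "c \<in> lp_space \<infinity> \<Gamma>" by (auto simp: lp_space_def intro: le_less_trans)
  then have low: "ennreal C\<^sub>1 * lp_norm \<infinity> \<Gamma> c \<le> Lp_norm \<infinity> lebesgue (shift_series \<Gamma> G c)"
    using stable by blast
  have "AE t in count_space \<Gamma>. ennreal (cmod (c t)) \<le> lp_norm \<infinity> \<Gamma> c"
    unfolding Lp_norm_def by (simp add: esssup_AE)
  then have "ennreal ?a \<le> lp_norm \<infinity> \<Gamma> c" using \<gamma> S(2) by (auto simp: AE_count_space)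
  then have "ennreal C\<^sub>1 * ennreal ?a \<le> ennreal C\<^sub>1 * lp_norm \<infinity> \<Gamma> c" by (rule mult_left_mono) simp
  note this also note low
  finally have low': "ennreal (C\<^sub>1 * ?a) \<le> Lp_norm \<infinity> lebesgue (shift_series \<Gamma> G c)"
    using C by (simp add: ennreal_mult)
  show ?thesis
  proof (rule ccontr)
    assume "\<not> ?thesis"
    then have "cmod (shift_series \<Gamma> G c x) \<le> C\<^sub>1 / 2 * ?a" for x by (meson less_imp_le not_le)
    then have "Lp_norm \<infinity> lebesgue (shift_series \<Gamma> G c) \<le> ennreal (C\<^sub>1 / 2 * ?a)"
      unfolding Lp_norm_def using meas by (auto intro!: esssup_I ennreal_leI)
    with low' have "ennreal (C\<^sub>1 * ?a) \<le> ennreal (C\<^sub>1 / 2 * ?a)" by (rule order.trans)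
    then have "C\<^sub>1 * ?a \<le> C\<^sub>1 / 2 * ?a" using C a by (simp only: ennreal_le_iff mult_nonneg_nonneg less_imp_le half_gt_zero)
    then show False using C a by simp
  qed
qed simp

text \<open>
  The bound for the tent-weighted sequence yields a point \<open>x\<close>; moving the point of evaluation of the series by
  up to \<open>\<delta>\<close> turns the estimate at \<open>x\<close> into a lower bound \<open>m\<close> on a whole interval, which an integral can
  see. If \<open>x\<close> is off the support of the tent, the convolution alone dominates \<open>C\<^sub>1 / 2 * a k\<close>, and \<open>m = 0\<close> is a
  lower bound on any interval.
\<close>

lemma local_stability:
  fixes c :: "real \<Rightarrow> complex"
  assumes stable: "\<forall>c \<in> lp_space \<infinity> \<Gamma>.
           ennreal C\<^sub>1 * lp_norm \<infinity> \<Gamma> c \<le> Lp_norm \<infinity> lebesgue (shift_series \<Gamma> G c)"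
    and C: "C\<^sub>1 > 0" and cont: "continuous_on UNIV G"
    and \<Gamma>: "unit_counts_le M \<Gamma>" and \<kappa>: "\<And>l. 0 \<le> \<kappa> l" "\<And>F. finite F \<Longrightarrow> sum \<kappa> F \<le> \<eta>" and N: "N > 0"
    and \<delta>: "0 < \<delta>" "\<delta> \<le> 1"
    and pert: "\<And>t s. 0 \<le> s \<Longrightarrow> s \<le> \<delta> \<Longrightarrow>
       cmod (G t) * min 1 (\<bar>t\<bar> / real N) + cmod (G (t + s) - G t) \<le> \<kappa> \<lfloor>t\<rfloor>"
    and summable: "\<And>x. (\<lambda>\<gamma>. c \<gamma> * G (x - \<gamma>)) summable_on \<Gamma>"
    and sum: "(\<lambda>i. block_kernel M N \<kappa> \<eta> i * block_max \<Gamma> N c (k + i)) summable_on UNIV"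
  obtains x m where "0 \<le> m" "{x..x + \<delta>} \<subseteq> {(of_int k - 2) * real N..(of_int k + 3) * real N}"
    "\<And>y. y \<in> {x..x + \<delta>} \<Longrightarrow> m \<le> cmod (shift_series \<Gamma> G c y)"
    "C\<^sub>1 / 2 * block_max \<Gamma> N c k
       \<le> m + (\<Sum>\<^sub>\<infinity>i. block_kernel M N \<kappa> \<eta> i * block_max \<Gamma> N c (k + i))"
proof -
  let ?Y = "\<Sum>\<^sub>\<infinity>i. block_kernel M N \<kappa> \<eta> i * block_max \<Gamma> N c (k + i)"
  let ?a = "block_max \<Gamma> N c k"
  let ?tc = "\<lambda>\<gamma>. tent N k \<gamma> * c \<gamma>"
  have "\<exists>x. C\<^sub>1 / 2 * ?a \<le> cmod (shift_series \<Gamma> G ?tc x)"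
    using block_max_attained[OF \<Gamma> N, of c k]
  proof
    assume "\<exists>\<gamma>\<in>in_block \<Gamma> N k. ?a = cmod (c \<gamma>)"
    then obtain \<gamma> where \<gamma>: "\<gamma> \<in> in_block \<Gamma> N k" "?a = cmod (c \<gamma>)" by blast
    define S where "S = (\<Union>j\<in>{k - 2..k + 1}. in_block \<Gamma> N j)"
    have "\<exists>x. C\<^sub>1 / 2 * cmod (?tc \<gamma>) \<le> cmod (shift_series \<Gamma> G ?tc x)"
    proof (rule sup_stability_attained[OF stable C cont])
      show "finite S" using in_block_finite[OF \<Gamma> N] by (simp add: S_def)
      show "S \<subseteq> \<Gamma>" by (auto simp: S_def in_block_def)
      show "\<gamma> \<in> S" using \<gamma>(1) by (auto simp: S_def)
      show "tent N k t * c t = 0" if t: "t \<in> \<Gamma> - S" for t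
      proof -
        have "tent N k t = 0"
        proof (rule ccontr)
          assume "tent N k t \<noteq> 0"
          from tent_nonzero(3)[OF N this] have "\<lfloor>t / real N\<rfloor> \<in> {k - 2..k + 1}" by auto
          with t show False by (auto simp: S_def in_block_def)
        qed
        then show ?thesis by simp
      qed
    qed
    moreover have "tent N k \<gamma> = 1" using \<gamma>(1) by (intro tent_eq_1[OF N]) (simp add: in_block_def)
    ultimately show ?thesis using \<gamma>(2) by simp
  qed (use C in auto)
  then obtain x where x: "C\<^sub>1 / 2 * ?a \<le> cmod (shift_series \<Gamma> G ?tc x)" by blast
  have bound: "C\<^sub>1 / 2 * ?a \<le> tent N k x * cmod (shift_series \<Gamma> G c (x + s)) + ?Y" if "0 \<le> s" "s \<le> \<delta>" for s
    using x shift_series_tent_le[OF \<Gamma> \<kappa> N pert[OF that] summable sum, of x] by linarith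
  define m where "m = max 0 (C\<^sub>1 / 2 * ?a - ?Y)"
  have m: "0 \<le> m" "C\<^sub>1 / 2 * ?a \<le> m + ?Y" unfolding m_def by linarith+
  have N1: "1 \<le> real N" using N by simp
  show thesis
  proof (cases "tent N k x = 0")
    case True
    then have "m = 0" using bound[of 0] \<delta> by (simp add: m_def)
    moreover have "{of_int k * real N..of_int k * real N + \<delta>}
        \<subseteq> {(of_int k - 2) * real N..(of_int k + 3) * real N}"
      using \<delta> N1 by (auto simp: algebra_simps)
    ultimately show thesis using m by (intro that[of m "of_int k * real N"]) auto
  next
    case False
    show thesis
    proof (rule that[of m x])
      show "{x..x + \<delta>} \<subseteq> {(of_int k - 2) * real N..(of_int k + 3) * real N}"
      proof -
        have "(of_int k + 3) * real N = (of_int k + 2) * real N + real N"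
          by (simp add: algebra_simps)
        then have "(of_int k - 2) * real N \<le> x" "x + \<delta> \<le> (of_int k + 3) * real N"
          using tent_nonzero(1,2)[OF N False] \<delta> N1 by linarith+
        then show ?thesis by auto
      qed
      fix y assume y: "y \<in> {x..x + \<delta>}"
      have "tent N k x * cmod (shift_series \<Gamma> G c y) \<le> 1 * cmod (shift_series \<Gamma> G c y)"
        using tent_range by (intro mult_right_mono) auto
      then show "m \<le> cmod (shift_series \<Gamma> G c y)"
        using bound[of "y - x"] y by (simp add: m_def)
    qed (use m in auto)
  qed
qed

section \<open>Passing between norms and sums\<close>

lemma sum_le_nn_integral_count_space:
  assumes F: "finite F" "F \<subseteq> A" and f: "\<And>x. 0 \<le> f x"
  shows "ennreal (sum f F) \<le> (\<integral>\<^sup>+ x. ennreal (f x) \<partial>count_space A)"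
proof -
  have "ennreal (sum f F) = (\<Sum>x\<in>F. ennreal (f x) * indicator F x)"
    using f by (simp add: sum_ennreal)
  also have "\<dots> = (\<integral>\<^sup>+ x. ennreal (f x) * indicator F x \<partial>count_space A)"
    by (rule nn_integral_count_space'[symmetric]) (use F in auto)
  also have "\<dots> \<le> (\<integral>\<^sup>+ x. ennreal (f x) \<partial>count_space A)"
    by (intro nn_integral_mono) (auto split: split_indicator)
  finally show ?thesis .
qed

lemma nn_integral_count_space_le:
  fixes f :: "'i \<Rightarrow> real"
  assumes f: "\<And>x. 0 \<le> f x" and B: "\<And>F. finite F \<Longrightarrow> F \<subseteq> A \<Longrightarrow> sum f F \<le> B"
  shows "(\<integral>\<^sup>+ x. ennreal (f x) \<partial>count_space A) \<le> ennreal B"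
proof -
  have s: "f summable_on A"
    by (rule nonneg_bdd_above_summable_on) (use f B in \<open>auto intro!: bdd_aboveI\<close>)
  then have abs: "Infinite_Set_Sum.abs_summable_on f A"
    by (simp add: f flip: abs_summable_equivalent)
  have "(\<integral>\<^sup>+ x. ennreal (f x) \<partial>count_space A) = ennreal (infsetsum f A)"
    using abs f by (rule nn_integral_conv_infsetsum)
  also have "infsetsum f A = infsum f A" using abs by (rule infsetsum_infsum)
  also have "ennreal (infsum f A) \<le> ennreal B"
    by (intro ennreal_leI infsum_le_finite_sums s B)
  finally show ?thesis .
qed

text \<open>
  A point lies in at most six of the enlarged blocks, so the step function with height
  \<open>m k powr r / 6\<close> on the \<open>k\<close>-th interval, summed over \<open>k\<close>, stays below \<open>cmod (f y) powr r\<close>. Putting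
  the factor \<open>1 / 6\<close> into the step function leaves \<open>f\<close> alone on the right, so that monotonicity
  of the integral suffices.
\<close>

lemma sum_interval_minorants_le:
  fixes f :: "real \<Rightarrow> complex" and x m :: "int \<Rightarrow> real"
  assumes m: "\<And>k. 0 \<le> m k" and \<delta>: "0 < \<delta>" and N: "N > 0" and r: "0 \<le> r"
    and sub: "\<And>k. {x k..x k + \<delta>} \<subseteq> {(of_int k - 2) * real N..(of_int k + 3) * real N}"
    and le: "\<And>k y. y \<in> {x k..x k + \<delta>} \<Longrightarrow> m k \<le> cmod (f y)" and F: "finite F"
  shows "ennreal (\<delta> / 6 * (\<Sum>k\<in>F. m k powr r)) \<le> (\<integral>\<^sup>+ y. ennreal (cmod (f y) powr r) \<partial>lebesgue)"
proof -
  let ?J = "\<lambda>k. {x k..x k + \<delta>}"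
  have "ennreal (\<delta> / 6 * (\<Sum>k\<in>F. m k powr r)) = (\<Sum>k\<in>F. ennreal (m k powr r / 6) * ennreal \<delta>)"
  proof -
    have "\<delta> / 6 * (\<Sum>k\<in>F. m k powr r) = (\<Sum>k\<in>F. m k powr r / 6 * \<delta>)"
      by (simp add: sum_distrib_left mult.commute)
    also have "ennreal \<dots> = (\<Sum>k\<in>F. ennreal (m k powr r / 6 * \<delta>))"
      using \<delta> by (intro sum_ennreal[symmetric]) simp
    finally show ?thesis using \<delta> by (simp only: ennreal_mult powr_ge_zero less_imp_le
          divide_nonneg_nonneg zero_le_numeral)
  qed
  also have "\<dots> = (\<Sum>k\<in>F. \<integral>\<^sup>+ y. ennreal (m k powr r / 6) * indicator (?J k) y \<partial>lebesgue)"
    using \<delta> by (intro sum.cong refl) (simp add: nn_integral_cmult_indicator)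
  also have "\<dots> = (\<integral>\<^sup>+ y. (\<Sum>k\<in>F. ennreal (m k powr r / 6) * indicator (?J k) y) \<partial>lebesgue)"
    by (intro nn_integral_sum[symmetric] borel_measurable_times_ennreal borel_measurable_const
        borel_measurable_indicator) simp
  also have "\<dots> \<le> (\<integral>\<^sup>+ y. ennreal (cmod (f y) powr r) \<partial>lebesgue)"
  proof (rule nn_integral_mono)
    fix y
    let ?K = "{k\<in>F. y \<in> ?J k}"
    have K: "finite ?K" using F by simp
    have "?K \<subseteq> {\<lceil>y / real N\<rceil> - 3..\<lceil>y / real N\<rceil> + 2}"
    proof
      fix k assume "k \<in> ?K"
      then have "y \<in> {(of_int k - 2) * real N..(of_int k + 3) * real N}" using sub[of k] by blast
      then have "of_int k - 2 \<le> y / real N" "y / real N \<le> of_int k + 3"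
        using N by (simp_all add: field_simps)
      then show "k \<in> {\<lceil>y / real N\<rceil> - 3..\<lceil>y / real N\<rceil> + 2}"
        unfolding atLeastAtMost_iff by linarith
    qed
    then have "card ?K \<le> card {\<lceil>y / real N\<rceil> - 3..\<lceil>y / real N\<rceil> + 2}"
      by (intro card_mono) auto
    then have card: "card ?K \<le> 6" by simp
    have "(\<Sum>k\<in>F. ennreal (m k powr r / 6) * indicator (?J k) y) = (\<Sum>k\<in>?K. ennreal (m k powr r / 6))"
      using F by (intro sum.mono_neutral_cong_right) (auto split: split_indicator)
    also have "\<dots> = ennreal (\<Sum>k\<in>?K. m k powr r / 6)" by (rule sum_ennreal) simp
    also have "\<dots> \<le> ennreal (cmod (f y) powr r)"
    proof (rule ennreal_leI)
      have "(\<Sum>k\<in>?K. m k powr r / 6) \<le> real (card ?K) * (cmod (f y) powr r / 6)"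
        by (rule sum_bounded_above) (use le m r in \<open>auto intro!: divide_right_mono powr_mono2\<close>)
      also have "\<dots> \<le> 6 * (cmod (f y) powr r / 6)"
        using card by (intro mult_right_mono) auto
      finally show "(\<Sum>k\<in>?K. m k powr r / 6) \<le> cmod (f y) powr r" by simp
    qed
    finally show "(\<Sum>k\<in>F. ennreal (m k powr r / 6) * indicator (?J k) y) \<le> ennreal (cmod (f y) powr r)" .
  qed
  finally show ?thesis .
qed

lemma norm_le_of_powr_sums:
  assumes E: "\<And>F. finite F \<Longrightarrow> F \<subseteq> A \<Longrightarrow> (\<Sum>\<gamma>\<in>F. cmod (c \<gamma>) powr r) \<le> E"
    and r: "0 < r" and \<gamma>: "\<gamma> \<in> A"
  shows "cmod (c \<gamma>) \<le> E powr (1 / r)"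
proof -
  have "cmod (c \<gamma>) powr r \<le> E" using E[of "{\<gamma>}"] \<gamma> by simp
  then have "(cmod (c \<gamma>) powr r) powr (1 / r) \<le> E powr (1 / r)"
    using r by (intro powr_mono2) auto
  then show ?thesis using r by (simp add: powr_powr)
qed

section \<open>Stability for finite exponents\<close>

text \<open>
  The constant \<open>R\<close> collects the losses: \<open>M * N\<close> points per block, the factor of the absorption with \<open>\<alpha> = C\<^sub>1 / 2\<close>,
  and \<open>6 / \<delta>\<close> from overlapping intervals of length \<open>\<delta>\<close>.
\<close>

lemma lp_stability:
  fixes \<Gamma> :: "real set" and G :: "real \<Rightarrow> complex" and C\<^sub>1 r :: real
  assumes sep: "separated_set \<Gamma>" and G: "G \<in> wiener_amalgam" and cont: "continuous_on UNIV G"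
    and C: "C\<^sub>1 > 0"
    and stable: "\<forall>c \<in> lp_space \<infinity> \<Gamma>.
           ennreal C\<^sub>1 * lp_norm \<infinity> \<Gamma> c \<le> Lp_norm \<infinity> lebesgue (shift_series \<Gamma> G c)"
    and r: "1 \<le> r"
  obtains R where "0 < R"
    "\<And>c. (\<integral>\<^sup>+ \<gamma>. ennreal (cmod (c \<gamma>) powr r) \<partial>count_space \<Gamma>) < \<infinity> \<Longrightarrow>
       (\<integral>\<^sup>+ x. ennreal (cmod (shift_series \<Gamma> G c x) powr r) \<partial>lebesgue) < \<infinity> \<Longrightarrow>
       (\<integral>\<^sup>+ \<gamma>. ennreal (cmod (c \<gamma>) powr r) \<partial>count_space \<Gamma>)
         \<le> ennreal (R * enn2real (\<integral>\<^sup>+ x. ennreal (cmod (shift_series \<Gamma> G c x) powr r) \<partial>lebesgue))"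
proof -
  obtain M where M: "M > 0" and \<Gamma>: "unit_counts_le M \<Gamma>"
    using separated_imp_unit_counts_le[OF sep] by blast
  obtain q :: "int \<Rightarrow> real" where q: "\<And>l. 0 \<le> q l" "q summable_on UNIV" "\<And>t. cmod (G t) \<le> q \<lfloor>t\<rfloor>"
    using wiener_majorant[OF G cont] by blast
  \<comment> \<open>\<open>88 = 2 * 4 * 11\<close>: four times the mass \<open>11 * M * \<eta>\<close> must not exceed \<open>C\<^sub>1 / 2\<close>\<close>
  define \<eta> where "\<eta> = C\<^sub>1 / (88 * real M)"
  have \<eta>: "0 < \<eta>" using C M by (simp add: \<eta>_def)
  obtain \<kappa> N \<delta> where \<kappa>: "\<And>l. 0 \<le> \<kappa> l" "\<And>F. finite F \<Longrightarrow> sum \<kappa> F \<le> \<eta>"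
    and N: "0 < N" and \<delta>: "0 < \<delta>" "\<delta> \<le> 1"
    and pert: "\<And>t s. 0 \<le> s \<Longrightarrow> s \<le> \<delta> \<Longrightarrow>
       cmod (G t) * min 1 (\<bar>t\<bar> / real N) + cmod (G (t + s) - G t) \<le> \<kappa> \<lfloor>t\<rfloor>"
    using small_perturbation_kernel[OF G cont \<eta>] by blast
  let ?V = "block_kernel M N \<kappa> \<eta>"
  note V = block_kernel_summable[OF \<kappa> N, of M] block_kernel_nonneg[OF \<kappa> N, of M]
  have V_small: "4 * infsum ?V UNIV \<le> C\<^sub>1 / 2"
    using block_kernel_infsum[OF \<kappa> N, of M] M by (simp add: \<eta>_def)
  define R where "R = real (M * N) * (2 * (2 / (C\<^sub>1 / 2)) powr r * (6 / \<delta>))"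
  have "0 < R" using M N C \<delta> by (simp add: R_def)
  moreover have "(\<integral>\<^sup>+ \<gamma>. ennreal (cmod (c \<gamma>) powr r) \<partial>count_space \<Gamma>)
         \<le> ennreal (R * enn2real (\<integral>\<^sup>+ x. ennreal (cmod (shift_series \<Gamma> G c x) powr r) \<partial>lebesgue))"
    if c: "(\<integral>\<^sup>+ \<gamma>. ennreal (cmod (c \<gamma>) powr r) \<partial>count_space \<Gamma>) < \<infinity>"
      and fin: "(\<integral>\<^sup>+ x. ennreal (cmod (shift_series \<Gamma> G c x) powr r) \<partial>lebesgue) < \<infinity>" for c
  proof -
    define E where "E = enn2real (\<integral>\<^sup>+ \<gamma>. ennreal (cmod (c \<gamma>) powr r) \<partial>count_space \<Gamma>)"
    define I where "I = enn2real (\<integral>\<^sup>+ x. ennreal (cmod (shift_series \<Gamma> G c x) powr r) \<partial>lebesgue)"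
    have I: "ennreal I = (\<integral>\<^sup>+ x. ennreal (cmod (shift_series \<Gamma> G c x) powr r) \<partial>lebesgue)" "0 \<le> I"
      using fin by (simp_all add: I_def less_top)
    have E: "(\<Sum>\<gamma>\<in>F. cmod (c \<gamma>) powr r) \<le> E" if F: "finite F" "F \<subseteq> \<Gamma>" for F
    proof -
      have "ennreal (\<Sum>\<gamma>\<in>F. cmod (c \<gamma>) powr r) \<le> (\<integral>\<^sup>+ \<gamma>. ennreal (cmod (c \<gamma>) powr r) \<partial>count_space \<Gamma>)"
        by (rule sum_le_nn_integral_count_space[OF F]) simp
      also have "\<dots> = ennreal E" using c by (simp add: E_def less_top)
      finally show ?thesis by (simp add: E_def)
    qed
    define B where "B = E powr (1 / r)"
    have cB: "cmod (c \<gamma>) \<le> B" if "\<gamma> \<in> \<Gamma>" for \<gamma>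
      unfolding B_def by (rule norm_le_of_powr_sums[OF E]) (use r that in auto)
    let ?a = "block_max \<Gamma> N c"
    note a0 = block_max_nonneg[OF \<Gamma> N, of c]
    have aB: "?a k \<le> B" for k
      using block_max_attained[OF \<Gamma> N, of c k] cB by (auto simp: in_block_def B_def)
    have a_fin: "(\<Sum>j\<in>J. ?a j powr r) \<le> E" if "finite J" for J
      by (rule sum_block_max_powr_le[OF \<Gamma> N _ E that]) (use r in auto)
    have a_sum: "(\<lambda>k. ?a k powr r) summable_on UNIV"
      by (rule nonneg_bdd_above_summable_on) (use a_fin in \<open>auto intro!: bdd_aboveI\<close>)
    have summable: "(\<lambda>\<gamma>. c \<gamma> * G (x - \<gamma>)) summable_on \<Gamma>" for x
      by (rule shift_series_summable[OF \<Gamma> q cB])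
    have V_sum: "(\<lambda>i. ?V i * ?a (k + i)) summable_on UNIV" for k
      by (rule bounded_times_summable(1)[OF V]) (use a0 aB in auto)
    define good where "good k x m \<longleftrightarrow> 0 \<le> m \<and>
        {x..x + \<delta>} \<subseteq> {(of_int k - 2) * real N..(of_int k + 3) * real N} \<and>
        (\<forall>y\<in>{x..x + \<delta>}. m \<le> cmod (shift_series \<Gamma> G c y)) \<and>
        C\<^sub>1 / 2 * ?a k \<le> m + (\<Sum>\<^sub>\<infinity>i. ?V i * ?a (k + i))" for k :: int and x m
    have "\<exists>x m. good k x m" for k
    proof (rule local_stability[OF stable C cont \<Gamma> \<kappa> N \<delta> pert summable V_sum[of k]])
      fix x m
      assume "0 \<le> m" "{x..x + \<delta>} \<subseteq> {(of_int k - 2) * real N..(of_int k + 3) * real N}"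
        "\<And>y. y \<in> {x..x + \<delta>} \<Longrightarrow> m \<le> cmod (shift_series \<Gamma> G c y)"
        "C\<^sub>1 / 2 * ?a k \<le> m + (\<Sum>\<^sub>\<infinity>i. ?V i * ?a (k + i))"
      then have "good k x m" unfolding good_def by blast
      then show ?thesis by blast
    qed
    then obtain x m where good: "\<And>k. good k (x k) (m k)" by metis
    have m: "0 \<le> m k"
      and J: "{x k..x k + \<delta>} \<subseteq> {(of_int k - 2) * real N..(of_int k + 3) * real N}"
      and le: "y \<in> {x k..x k + \<delta>} \<Longrightarrow> m k \<le> cmod (shift_series \<Gamma> G c y)"
      and ineq: "C\<^sub>1 / 2 * ?a k \<le> m k + (\<Sum>\<^sub>\<infinity>i. ?V i * ?a (k + i))" for k y
      using good[of k] unfolding good_def by blast+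
    have m_sum: "(\<Sum>k\<in>F. m k powr r) \<le> 6 / \<delta> * I" if F: "finite F" for F
    proof -
      have "ennreal (\<delta> / 6 * (\<Sum>k\<in>F. m k powr r)) \<le> ennreal I"
        unfolding I(1) by (rule sum_interval_minorants_le[OF m \<delta>(1) N _ J le F]) (use r in auto)
      then have "\<delta> / 6 * (\<Sum>k\<in>F. m k powr r) \<le> I" using I(2) by simp
      then show ?thesis using \<delta>(1) by (simp add: field_simps)
    qed
    have total: "(\<Sum>\<^sub>\<infinity>k. ?a k powr r) \<le> 2 * (2 / (C\<^sub>1 / 2)) powr r * (6 / \<delta> * I)"
      by (rule absorb_convolution[OF a0 a_sum m m_sum V V_small _ r ineq]) (use C in auto)
    have blocks: "(\<Sum>j\<in>J. ?a j powr r) \<le> 2 * (2 / (C\<^sub>1 / 2)) powr r * (6 / \<delta> * I)" if "finite J" for J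
      by (rule order.trans[OF finite_sum_le_infsum[OF a_sum that] total]) auto
    have "(\<Sum>\<gamma>\<in>F. cmod (c \<gamma>) powr r) \<le> R * I" if F: "finite F" "F \<subseteq> \<Gamma>" for F
      using sum_powr_le_block_max[OF \<Gamma> N _ blocks F] r by (simp add: R_def mult.assoc)
    then show ?thesis
      unfolding I_def by (intro nn_integral_count_space_le) auto
  qed
  ultimately show thesis by (rule that)
qed

theorem theorem1p6:
  fixes \<Gamma> :: "real set" and G :: "real \<Rightarrow> complex" and C\<^sub>1 :: real
  assumes "separated_set \<Gamma>"
    and "relatively_dense \<Gamma>"
    and "G \<in> wiener_amalgam"
    and "continuous_on UNIV G"
    and "C\<^sub>1 > 0"
    and "\<forall>c \<in> lp_space \<infinity> \<Gamma>.
           ennreal C\<^sub>1 * lp_norm \<infinity> \<Gamma> c \<le> Lp_norm \<infinity> lebesgue (shift_series \<Gamma> G c)"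
  shows "\<forall>p::ennreal. 1 \<le> p \<longrightarrow>
           (\<exists>C::real. C > 0 \<and>
              (\<forall>c \<in> lp_space p \<Gamma>.
                 ennreal C * lp_norm p \<Gamma> c \<le> Lp_norm p lebesgue (shift_series \<Gamma> G c)))"
proof (intro allI impI)
  fix p :: ennreal assume p: "1 \<le> p"
  show "\<exists>C::real. C > 0 \<and> (\<forall>c \<in> lp_space p \<Gamma>.
          ennreal C * lp_norm p \<Gamma> c \<le> Lp_norm p lebesgue (shift_series \<Gamma> G c))"
  proof (cases "p = \<infinity>")
    case True
    then show ?thesis using assms(5,6) by blast
  next
    case False
    define r where "r = enn2real p"
    have r: "1 \<le> r"
    proof -
      have "enn2real 1 \<le> enn2real p" by (rule enn2real_mono[OF p]) (use False in \<open>simp add: less_top\<close>)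
      then show ?thesis by (simp add: r_def)
    qed
    obtain R where R: "0 < R"
      and le: "\<And>c. (\<integral>\<^sup>+ \<gamma>. ennreal (cmod (c \<gamma>) powr r) \<partial>count_space \<Gamma>) < \<infinity> \<Longrightarrow>
       (\<integral>\<^sup>+ x. ennreal (cmod (shift_series \<Gamma> G c x) powr r) \<partial>lebesgue) < \<infinity> \<Longrightarrow>
       (\<integral>\<^sup>+ \<gamma>. ennreal (cmod (c \<gamma>) powr r) \<partial>count_space \<Gamma>)
         \<le> ennreal (R * enn2real (\<integral>\<^sup>+ x. ennreal (cmod (shift_series \<Gamma> G c x) powr r) \<partial>lebesgue))"
      using lp_stability[OF assms(1,3-6) r] by blast
    define C where "C = (1 / R) powr (1 / r)"
    have C: "0 < C" using R by (simp add: C_def)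
    have "ennreal C * lp_norm p \<Gamma> c \<le> Lp_norm p lebesgue (shift_series \<Gamma> G c)"
      if c: "c \<in> lp_space p \<Gamma>" for c
    proof -
      define E where "E = (\<integral>\<^sup>+ \<gamma>. ennreal (cmod (c \<gamma>) powr r) \<partial>count_space \<Gamma>)"
      define I where "I = (\<integral>\<^sup>+ x. ennreal (cmod (shift_series \<Gamma> G c x) powr r) \<partial>lebesgue)"
      have cE: "lp_norm p \<Gamma> c = (if E = \<infinity> then \<infinity> else ennreal (enn2real E powr (1 / r)))"
        using False by (simp add: Lp_norm_def r_def E_def)
      have FI: "Lp_norm p lebesgue (shift_series \<Gamma> G c)
          = (if I = \<infinity> then \<infinity> else ennreal (enn2real I powr (1 / r)))"
        using False by (simp add: Lp_norm_def r_def I_def)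
      have "lp_norm p \<Gamma> c \<noteq> \<infinity>" using c by (auto simp: lp_space_def)
      then have "E \<noteq> \<infinity>" unfolding cE by (cases "E = \<infinity>") simp_all
      then have E: "E < \<infinity>" by (simp add: less_top)
      show ?thesis
      proof (cases "I = \<infinity>")
        case True
        then show ?thesis by (simp add: FI)
      next
        case I: False
        then have "E \<le> ennreal (R * enn2real I)"
          using le[of c] E by (simp add: E_def I_def less_top)
        then have "enn2real E \<le> R * enn2real I"
          using R by (intro enn2real_leI) auto
        then have "1 / R * enn2real E \<le> enn2real I" using R by (simp add: field_simps)
        then have "(1 / R * enn2real E) powr (1 / r) \<le> enn2real I powr (1 / r)"
          using R r by (intro powr_mono2) auto
        then have "C * enn2real E powr (1 / r) \<le> enn2real I powr (1 / r)"
          using R by (simp add: C_def powr_mult powr_divide)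
        then have "ennreal (C * enn2real E powr (1 / r)) \<le> ennreal (enn2real I powr (1 / r))"
          by (rule ennreal_leI)
        moreover have "E \<noteq> \<infinity>" using E by simp
        ultimately show ?thesis using I C by (simp add: cE FI ennreal_mult)
      qed
    qed
    with C show ?thesis by blast
  qed
qed

end
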